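(* Let $(V,\omega)$ be a nondegenerate simple CFT type vertex operator algebra generated by $V_1$, with $\dim V_1=d$ and $L(1)V_1=0$. Suppose there is a chain $0=\omega^0\prec\omega^1\prec\cdots\prec\omega^{d-1}\prec\omega^d=\omega$ in $\operatorname{Sc}(V,\omega)$ such that $\dim C_V(C_V(\langle\omega^i-\omega^{i-1}\rangle))_1\ne0$ for $i=1,\dots,d$. Then $(V,\omega)$ is isomorphic to the Heisenberg vertex operator algebra $(V_{\widehat{\mathfrak h}}(1,0),\omega_0)$ with $\mathfrak h=V_1$.
   Context: $Y(u,z)=\sum_nu_nz^{-n-1}$, $Y(\omega,z)=\sum_nL(n)z^{-n-2}$. Nondegenerate simple CFT type: $V$ simple, $V=\bigoplus_{n\ge0}V_n$, $V_0=\mathbb C\mathbf 1$, and the symmetric form on $V_1$ defined by $u_1v=\langle u,v\rangle\mathbf 1$ is nondegenerate. Semi-conformal vector of $(V,\omega)$: conformal vector $\omega'$ of a vertex operator subalgebra $(U,\omega')$ with $\omega_n|_U=\omega'_n|_U$ for all $n\ge0$; $\operatorname{Sc}(V,\omega)$ is the set of these. $C_V(U)=\{v:u_nv=0\ \forall u\in U,n\ge0\}$; $\langle\omega'\rangle$ is the vertex subalgebra generated by $\omega'$. Partial order on $\operatorname{Sc}(V,\omega)$: $\omega^1\preceq\omega^2$ iff $C_V(C_V(\langle\omega^1\rangle))\subseteq C_V(C_V(\langle\omega^2\rangle))$; $\prec$ means $\preceq$ and $\ne$. For a finite-dimensional space $\mathfrak h$ with nondegenerate symmetric form and orthonormal basis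 $(h_i)$, $V_{\widehat{\mathfrak h}}(1,0)$ is the level 1 Heisenberg vertex algebra and $\omega_0=\frac12\sum_ih_i(-1)^2\mathbf 1$. *)

theory Defs
  imports Complex_Main "HOL-Library.Function_Algebras"
begin

text \<open>Vertex (operator) algebras over the complex numbers.  A vertex algebra is given by
  an ambient additive group 'v with a complex scalar multiplication sc, a carrier
  subspace S, the modes Y u n v (= u_n v, i.e. Y(u,z) = sum_n u_n z^(-n-1)) and a vacuum
  vector.  Everything is relativised to the carrier S.\<close>

definition lin_subspace :: "(complex \<Rightarrow> 'v::ab_group_add \<Rightarrow> 'v) \<Rightarrow> 'v set \<Rightarrow> bool" where
  "lin_subspace sc S \<longleftrightarrow> 0 \<in> S \<and> (\<forall>x\<in>S. \<forall>y\<in>S. x + y \<in> S) \<and> (\<forall>c. \<forall>x\<in>S. sc c x \<in> S)"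

definition lin_span :: "(complex \<Rightarrow> 'v::ab_group_add \<Rightarrow> 'v) \<Rightarrow> 'v set \<Rightarrow> 'v set" where
  "lin_span sc B = {v. \<exists>K c. finite K \<and> K \<subseteq> B \<and> v = (\<Sum>b\<in>K. sc (c b) b)}"

definition ibin :: "int \<Rightarrow> nat \<Rightarrow> complex" where
  "ibin p i = (of_int p :: complex) gchoose i"

definition isign :: "int \<Rightarrow> complex" where
  "isign r = (if even r then 1 else -1)"

text \<open>Borcherds (Jacobi) identity; the sums over i >= 0 are finite, and we state the identity
  for every cut-off N beyond which all summands vanish.\<close>
definition borcherds :: "(complex \<Rightarrow> 'v::ab_group_add \<Rightarrow> 'v) \<Rightarrow> ('v \<Rightarrow> int \<Rightarrow> 'v \<Rightarrow> 'v) \<Rightarrow> 'v set \<Rightarrow> bool" where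
  "borcherds sc Y S \<longleftrightarrow>
    (\<forall>u\<in>S. \<forall>v\<in>S. \<forall>w\<in>S. \<forall>p q r :: int. \<forall>N :: nat.
       (\<forall>i\<ge>N. Y u (r + int i) v = 0 \<and> Y v (q + int i) w = 0 \<and> Y u (p + int i) w = 0) \<longrightarrow>
       (\<Sum>i<N. sc (ibin p i) (Y (Y u (r + int i) v) (p + q - int i) w)) =
       (\<Sum>i<N. sc ((-1) ^ i * ibin r i)
           (Y u (p + r - int i) (Y v (q + int i) w)
            - sc (isign r) (Y v (q + r - int i) (Y u (p + int i) w)))))"

definition vertex_algebra ::
  "(complex \<Rightarrow> 'v::ab_group_add \<Rightarrow> 'v) \<Rightarrow> ('v \<Rightarrow> int \<Rightarrow> 'v \<Rightarrow> 'v) \<Rightarrow> 'v \<Rightarrow> 'v set \<Rightarrow> bool" where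
  "vertex_algebra sc Y vac S \<longleftrightarrow>
     lin_subspace sc S \<and> vac \<in> S \<and>
     (\<forall>u\<in>S. \<forall>v\<in>S. \<forall>n. Y u n v \<in> S) \<and>
     (\<forall>u\<in>S. \<forall>u'\<in>S. \<forall>v\<in>S. \<forall>n. Y (u + u') n v = Y u n v + Y u' n v) \<and>
     (\<forall>u\<in>S. \<forall>v\<in>S. \<forall>v'\<in>S. \<forall>n. Y u n (v + v') = Y u n v + Y u n v') \<and>
     (\<forall>c. \<forall>u\<in>S. \<forall>v\<in>S. \<forall>n. Y (sc c u) n v = sc c (Y u n v) \<and> Y u n (sc c v) = sc c (Y u n v)) \<and>
     (\<forall>u\<in>S. \<forall>v\<in>S. \<exists>N. \<forall>n\<ge>N. Y u n v = 0) \<and>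
     (\<forall>v\<in>S. \<forall>n. Y vac n v = (if n = -1 then v else 0)) \<and>
     (\<forall>u\<in>S. Y u (-1) vac = u \<and> (\<forall>n\<ge>0. Y u n vac = 0)) \<and>
     borcherds sc Y S"

text \<open>L(0)-weight spaces: L(n) = omega_(n+1).\<close>
definition wt :: "(complex \<Rightarrow> 'v::ab_group_add \<Rightarrow> 'v) \<Rightarrow> ('v \<Rightarrow> int \<Rightarrow> 'v \<Rightarrow> 'v) \<Rightarrow> 'v \<Rightarrow> 'v set \<Rightarrow> int \<Rightarrow> 'v set" where
  "wt sc Y \<omega> S k = {v\<in>S. Y \<omega> 1 v = sc (of_int k) v}"

definition conformal_vector ::
  "(complex \<Rightarrow> 'v::ab_group_add \<Rightarrow> 'v) \<Rightarrow> ('v \<Rightarrow> int \<Rightarrow> 'v \<Rightarrow> 'v) \<Rightarrow> 'v set \<Rightarrow> 'v \<Rightarrow> bool" where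
  "conformal_vector sc Y S \<omega> \<longleftrightarrow>
     \<omega> \<in> S \<and>
     (\<exists>c::complex. \<forall>m n :: int. \<forall>v\<in>S.
        Y \<omega> (m + 1) (Y \<omega> (n + 1) v) - Y \<omega> (n + 1) (Y \<omega> (m + 1) v) =
        sc (of_int (m - n)) (Y \<omega> (m + n + 1) v)
        + (if m + n = 0 then sc ((of_int m ^ 3 - of_int m) / 12 * c) v else 0)) \<and>
     (\<forall>u\<in>S. \<forall>v\<in>S. \<forall>n. Y (Y \<omega> 0 u) n v = sc (- of_int n) (Y u (n - 1) v)) \<and>
     (\<forall>v\<in>S. \<exists>K f. finite K \<and> (\<forall>k\<in>K. f k \<in> wt sc Y \<omega> S k) \<and> v = (\<Sum>k\<in>K. f k)) \<and>
     (\<forall>k. \<exists>B. finite B \<and> B \<subseteq> wt sc Y \<omega> S k \<and> wt sc Y \<omega> S k \<subseteq> lin_span sc B) \<and>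
     (\<exists>k0. \<forall>k<k0. wt sc Y \<omega> S k = {0})"

definition voa ::
  "(complex \<Rightarrow> 'v::ab_group_add \<Rightarrow> 'v) \<Rightarrow> ('v \<Rightarrow> int \<Rightarrow> 'v \<Rightarrow> 'v) \<Rightarrow> 'v \<Rightarrow> 'v \<Rightarrow> 'v set \<Rightarrow> bool" where
  "voa sc Y vac \<omega> S \<longleftrightarrow> vertex_algebra sc Y vac S \<and> conformal_vector sc Y S \<omega>"

definition vertex_subalgebra ::
  "(complex \<Rightarrow> 'v::ab_group_add \<Rightarrow> 'v) \<Rightarrow> ('v \<Rightarrow> int \<Rightarrow> 'v \<Rightarrow> 'v) \<Rightarrow> 'v \<Rightarrow> 'v set \<Rightarrow> 'v set \<Rightarrow> bool" where
  "vertex_subalgebra sc Y vac S U \<longleftrightarrow>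
     U \<subseteq> S \<and> lin_subspace sc U \<and> vac \<in> U \<and> (\<forall>u\<in>U. \<forall>v\<in>U. \<forall>n. Y u n v \<in> U)"

definition gen_subalg ::
  "(complex \<Rightarrow> 'v::ab_group_add \<Rightarrow> 'v) \<Rightarrow> ('v \<Rightarrow> int \<Rightarrow> 'v \<Rightarrow> 'v) \<Rightarrow> 'v \<Rightarrow> 'v set \<Rightarrow> 'v set \<Rightarrow> 'v set" where
  "gen_subalg sc Y vac S X = \<Inter>{U. vertex_subalgebra sc Y vac S U \<and> X \<subseteq> U}"

definition commutant :: "('v::ab_group_add \<Rightarrow> int \<Rightarrow> 'v \<Rightarrow> 'v) \<Rightarrow> 'v set \<Rightarrow> 'v set \<Rightarrow> 'v set" where
  "commutant Y S U = {v\<in>S. \<forall>u\<in>U. \<forall>n\<ge>0. Y u n v = 0}"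

definition semi_conformal ::
  "(complex \<Rightarrow> 'v::ab_group_add \<Rightarrow> 'v) \<Rightarrow> ('v \<Rightarrow> int \<Rightarrow> 'v \<Rightarrow> 'v) \<Rightarrow> 'v \<Rightarrow> 'v \<Rightarrow> 'v set \<Rightarrow> 'v set" where
  "semi_conformal sc Y vac \<omega> S =
     {\<omega>'. \<exists>U. vertex_subalgebra sc Y vac S U \<and> voa sc Y vac \<omega>' U \<and>
            (\<forall>u\<in>U. \<forall>n\<ge>0. Y \<omega> n u = Y \<omega>' n u)}"

definition dcomm ::
  "(complex \<Rightarrow> 'v::ab_group_add \<Rightarrow> 'v) \<Rightarrow> ('v \<Rightarrow> int \<Rightarrow> 'v \<Rightarrow> 'v) \<Rightarrow> 'v \<Rightarrow> 'v set \<Rightarrow> 'v \<Rightarrow> 'v set" where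
  "dcomm sc Y vac S x = commutant Y S (commutant Y S (gen_subalg sc Y vac S {x}))"

definition sc_le ::
  "(complex \<Rightarrow> 'v::ab_group_add \<Rightarrow> 'v) \<Rightarrow> ('v \<Rightarrow> int \<Rightarrow> 'v \<Rightarrow> 'v) \<Rightarrow> 'v \<Rightarrow> 'v set \<Rightarrow> 'v \<Rightarrow> 'v \<Rightarrow> bool" where
  "sc_le sc Y vac S x y \<longleftrightarrow> dcomm sc Y vac S x \<subseteq> dcomm sc Y vac S y"

definition sc_less ::
  "(complex \<Rightarrow> 'v::ab_group_add \<Rightarrow> 'v) \<Rightarrow> ('v \<Rightarrow> int \<Rightarrow> 'v \<Rightarrow> 'v) \<Rightarrow> 'v \<Rightarrow> 'v set \<Rightarrow> 'v \<Rightarrow> 'v \<Rightarrow> bool" where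
  "sc_less sc Y vac S x y \<longleftrightarrow> sc_le sc Y vac S x y \<and> x \<noteq> y"

definition va_ideal ::
  "(complex \<Rightarrow> 'v::ab_group_add \<Rightarrow> 'v) \<Rightarrow> ('v \<Rightarrow> int \<Rightarrow> 'v \<Rightarrow> 'v) \<Rightarrow> 'v set \<Rightarrow> 'v set \<Rightarrow> bool" where
  "va_ideal sc Y S I \<longleftrightarrow> I \<subseteq> S \<and> lin_subspace sc I \<and>
     (\<forall>u\<in>S. \<forall>v\<in>I. \<forall>n. Y u n v \<in> I \<and> Y v n u \<in> I)"

definition simple_va ::
  "(complex \<Rightarrow> 'v::ab_group_add \<Rightarrow> 'v) \<Rightarrow> ('v \<Rightarrow> int \<Rightarrow> 'v \<Rightarrow> 'v) \<Rightarrow> 'v set \<Rightarrow> bool" where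
  "simple_va sc Y S \<longleftrightarrow> S \<noteq> {0} \<and> (\<forall>I. va_ideal sc Y S I \<longrightarrow> I = {0} \<or> I = S)"

definition nondeg_simple_CFT ::
  "(complex \<Rightarrow> 'v::ab_group_add \<Rightarrow> 'v) \<Rightarrow> ('v \<Rightarrow> int \<Rightarrow> 'v \<Rightarrow> 'v) \<Rightarrow> 'v \<Rightarrow> 'v \<Rightarrow> 'v set \<Rightarrow> bool" where
  "nondeg_simple_CFT sc Y vac \<omega> S \<longleftrightarrow>
     simple_va sc Y S \<and>
     (\<forall>k<0. wt sc Y \<omega> S k = {0}) \<and>
     wt sc Y \<omega> S 0 = {sc c vac | c. True} \<and>
     (\<forall>u\<in>wt sc Y \<omega> S 1. (\<forall>v\<in>wt sc Y \<omega> S 1. Y u 1 v = 0) \<longrightarrow> u = 0)"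

definition voa_iso ::
  "(complex \<Rightarrow> 'v::ab_group_add \<Rightarrow> 'v) \<Rightarrow> ('v \<Rightarrow> int \<Rightarrow> 'v \<Rightarrow> 'v) \<Rightarrow> 'v \<Rightarrow> 'v \<Rightarrow> 'v set \<Rightarrow>
   (complex \<Rightarrow> 'w::ab_group_add \<Rightarrow> 'w) \<Rightarrow> ('w \<Rightarrow> int \<Rightarrow> 'w \<Rightarrow> 'w) \<Rightarrow> 'w \<Rightarrow> 'w \<Rightarrow> 'w set \<Rightarrow>
   ('v \<Rightarrow> 'w) \<Rightarrow> bool" where
  "voa_iso sc Y vac \<omega> S sc' Y' vac' \<omega>' S' \<phi> \<longleftrightarrow>
     bij_betw \<phi> S S' \<and>
     (\<forall>u\<in>S. \<forall>v\<in>S. \<phi> (u + v) = \<phi> u + \<phi> v) \<and>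
     (\<forall>c. \<forall>u\<in>S. \<phi> (sc c u) = sc' c (\<phi> u)) \<and>
     \<phi> vac = vac' \<and> \<phi> \<omega> = \<omega>' \<and>
     (\<forall>u\<in>S. \<forall>v\<in>S. \<forall>n. \<phi> (Y u n v) = Y' (\<phi> u) n (\<phi> v))"

text \<open>Using an orthonormal basis h_1..h_d of h, V_h(1,0) = C[h_i(-n) : i < d, n >= 1].
  A monomial is an exponent function on pairs (i,n) (standing for the variable h_i(-n));
  a state is a finitely supported coefficient function on monomials.\<close>

type_synonym hmono = "nat \<times> nat \<Rightarrow> nat"
type_synonym hstate = "hmono \<Rightarrow> complex"

definition fock_sc :: "complex \<Rightarrow> hstate \<Rightarrow> hstate" where
  "fock_sc c f = (\<lambda>m. c * f m)"

definition hmono_ok :: "nat \<Rightarrow> hmono \<Rightarrow> bool" where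
  "hmono_ok d m \<longleftrightarrow> finite {k. m k \<noteq> 0} \<and> (\<forall>i n. m (i, n) \<noteq> 0 \<longrightarrow> i < d \<and> 1 \<le> n)"

definition Fock :: "nat \<Rightarrow> hstate set" where
  "Fock d = {f. finite {m. f m \<noteq> 0} \<and> (\<forall>m. f m \<noteq> 0 \<longrightarrow> hmono_ok d m)}"

definition fock_vac :: hstate where
  "fock_vac = (\<lambda>m. if m = (\<lambda>_. 0) then 1 else 0)"

definition xmul :: "nat \<times> nat \<Rightarrow> hstate \<Rightarrow> hstate" where
  "xmul k f = (\<lambda>m. if 0 < m k then f (m(k := m k - 1)) else 0)"

definition xder :: "nat \<times> nat \<Rightarrow> hstate \<Rightarrow> hstate" where
  "xder k f = (\<lambda>m. of_nat (Suc (m k)) * f (m(k := Suc (m k))))"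

text \<open>Heisenberg modes h_i(n) at level 1: [h_i(m), h_j(n)] = m delta_ij delta_(m+n,0)\<close>
definition hmode :: "nat \<Rightarrow> int \<Rightarrow> hstate \<Rightarrow> hstate" where
  "hmode i n f = (if 0 < n then fock_sc (of_int n) (xder (i, nat n) f)
                  else if n < 0 then xmul (i, nat (- n)) f else 0)"

text \<open>the unique vertex algebra structure on the Fock space with vacuum 1 and
  Y(h_i(-1)1, z) = sum_n h_i(n) z^(-n-1) (extended by 0 outside the carrier)\<close>
definition heisY :: "nat \<Rightarrow> hstate \<Rightarrow> int \<Rightarrow> hstate \<Rightarrow> hstate" where
  "heisY d = (THE Y. vertex_algebra fock_sc Y fock_vac (Fock d) \<and>
                (\<forall>u n v. u \<notin> Fock d \<or> v \<notin> Fock d \<longrightarrow> Y u n v = 0) \<and>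
                (\<forall>i<d. \<forall>n. \<forall>f\<in>Fock d. Y (hmode i (-1) fock_vac) n f = hmode i n f))"

definition heis_omega :: "nat \<Rightarrow> hstate" where
  "heis_omega d = fock_sc (1/2) (\<Sum>i<d. hmode i (-1) (hmode i (-1) fock_vac))"

end

theory Submission
  imports Defs
begin

text \<open>
  Put \<open>\<eta>\<^sub>i = \<omega>\<^sup>i - \<omega>\<^sup>i\<^sup>-\<^sup>1\<close>. Semi-conformality says that \<open>\<omega> - \<omega>\<^sup>j\<close> commutes with \<open>\<omega>\<^sup>j\<close>, hence with the double
  commutant of \<open>\<omega>\<^sup>j\<close>, which contains \<open>\<omega>\<^sup>i\<close> for \<open>i \<le> j\<close>; so the \<open>\<eta>\<^sub>i\<close> commute pairwise, and so do
  their double commutants. A nonzero weight one vector \<open>v\<^sub>i\<close> in the double commutant of \<open>\<eta>\<^sub>i\<close> satisfies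
  \<open>(\<eta>\<^sub>j)\<^sub>1 v\<^sub>i = \<delta>\<^sub>i\<^sub>j v\<^sub>i\<close>, because the \<open>\<eta>\<^sub>j\<close> sum to \<open>\<omega>\<close>. Hence the \<open>v\<^sub>i\<close> form a basis of the
  weight one space, which is therefore abelian with an orthogonal basis, and after rescaling their
  modes satisfy the Heisenberg relations. The resulting linear map from the Fock space is injective
  because differentiation detects nonconstant polynomials, and surjective because \<open>V\<close> is generated in
  weight one. The vertex algebra structure on the Fock space exists by transport along this
  map and is unique by the associativity formula. Finally \<open>\<omega>\<close> and the quadratic vector \<open>\<omega>\<^sub>0\<close> are
  treated alike by all annihilation operators, so they differ by a multiple of the vacuum, which
  vanishes by weight.
\<close>

section \<open>Consequences of the Borcherds identity\<close>

lemma ibin_0 [simp]: "ibin p 0 = 1"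
  by (simp add: ibin_def)

lemma ibin_zero: "ibin 0 i = (if i = 0 then 1 else 0)"
  by (cases i) (simp_all add: ibin_def)

lemma ibin_minus_one: "ibin (-1) i = (-1) ^ i"
proof -
  have "(of_nat i :: complex) gchoose i = 1"
    by (metis binomial_gbinomial binomial_n_n of_nat_1)
  then show ?thesis using gbinomial_minus[of "1::complex" i] by (simp add: ibin_def)
qed

lemma sum_lessThan_only_zero:
  "N \<ge> 1 \<Longrightarrow> (\<And>i. i \<noteq> 0 \<Longrightarrow> f i = (0::'b::comm_monoid_add)) \<Longrightarrow> (\<Sum>i<N::nat. f i) = f 0"
  by (subst sum.mono_neutral_right[of _ "{0}"]) auto

lemma sum_lessThan_extend:
  "M \<le> N \<Longrightarrow> (\<And>i. i \<ge> M \<Longrightarrow> f i = (0::'b::comm_monoid_add)) \<Longrightarrow> (\<Sum>i<N::nat. f i) = (\<Sum>i<M. f i)"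
  by (rule sum.mono_neutral_right) auto

locale vertex_alg = vector_space sc
  for sc :: "complex \<Rightarrow> 'v::ab_group_add \<Rightarrow> 'v" +
  fixes Y :: "'v \<Rightarrow> int \<Rightarrow> 'v \<Rightarrow> 'v" and vac :: 'v and S :: "'v set"
  assumes va: "vertex_algebra sc Y vac S"
begin

section \<open>The vertex algebra axioms as separate facts\<close>

lemma subspace_S: "subspace S"
  using va[unfolded vertex_algebra_def, THEN conjunct1] unfolding lin_subspace_def subspace_def by blast

lemmas zero_in [simp] = subspace_0[OF subspace_S]
  and add_in = subspace_add[OF subspace_S]
  and diff_in = subspace_diff[OF subspace_S]
  and sc_in = subspace_scale[OF subspace_S]
  and sum_in = subspace_sum[OF subspace_S]

lemma vac_in [simp]: "vac \<in> S"
  using va[unfolded vertex_algebra_def, THEN conjunct2, THEN conjunct1] by blast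

lemma Y_in: "u \<in> S \<Longrightarrow> v \<in> S \<Longrightarrow> Y u n v \<in> S"
  using va[unfolded vertex_algebra_def, THEN conjunct2, THEN conjunct2, THEN conjunct1] by blast

lemma Y_add_left: "u \<in> S \<Longrightarrow> u' \<in> S \<Longrightarrow> v \<in> S \<Longrightarrow> Y (u + u') n v = Y u n v + Y u' n v"
  using va[unfolded vertex_algebra_def, THEN conjunct2, THEN conjunct2, THEN conjunct2,
      THEN conjunct1] by blast

lemma Y_add_right: "u \<in> S \<Longrightarrow> v \<in> S \<Longrightarrow> v' \<in> S \<Longrightarrow> Y u n (v + v') = Y u n v + Y u n v'"
  using va[unfolded vertex_algebra_def, THEN conjunct2, THEN conjunct2, THEN conjunct2,
      THEN conjunct2, THEN conjunct1] by blast

lemma Y_sc_left: "u \<in> S \<Longrightarrow> v \<in> S \<Longrightarrow> Y (sc c u) n v = sc c (Y u n v)"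
  using va[unfolded vertex_algebra_def, THEN conjunct2, THEN conjunct2, THEN conjunct2,
      THEN conjunct2, THEN conjunct2, THEN conjunct1] by blast

lemma Y_sc_right: "u \<in> S \<Longrightarrow> v \<in> S \<Longrightarrow> Y u n (sc c v) = sc c (Y u n v)"
  using va[unfolded vertex_algebra_def, THEN conjunct2, THEN conjunct2, THEN conjunct2,
      THEN conjunct2, THEN conjunct2, THEN conjunct1] by blast

lemma Y_zero_left [simp]: "v \<in> S \<Longrightarrow> Y 0 n v = 0"
  using Y_sc_left[of 0 v 0 n] by simp

lemma Y_zero_right [simp]: "u \<in> S \<Longrightarrow> Y u n 0 = 0"
  using Y_sc_right[of u 0 n 0] by simp

lemma Y_diff_left: "u \<in> S \<Longrightarrow> u' \<in> S \<Longrightarrow> v \<in> S \<Longrightarrow> Y (u - u') n v = Y u n v - Y u' n v"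
  using Y_add_left[of "u - u'" u' v n] diff_in[of u u'] by (simp add: algebra_simps)

lemma Y_diff_right: "u \<in> S \<Longrightarrow> v \<in> S \<Longrightarrow> v' \<in> S \<Longrightarrow> Y u n (v - v') = Y u n v - Y u n v'"
  using Y_add_right[of u "v - v'" v' n] diff_in[of v v'] by (simp add: algebra_simps)

lemma Y_sum_left:
  "(\<And>x. x \<in> K \<Longrightarrow> f x \<in> S) \<Longrightarrow> v \<in> S \<Longrightarrow> Y (sum f K) n v = (\<Sum>x\<in>K. Y (f x) n v)"
  by (induction K rule: infinite_finite_induct) (auto simp: Y_add_left sum_in)

lemma Y_sum_right:
  "u \<in> S \<Longrightarrow> (\<And>x. x \<in> K \<Longrightarrow> f x \<in> S) \<Longrightarrow> Y u n (sum f K) = (\<Sum>x\<in>K. Y u n (f x))"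
  by (induction K rule: infinite_finite_induct) (auto simp: Y_add_right sum_in)

lemma Y_vac_left: "v \<in> S \<Longrightarrow> Y vac n v = (if n = -1 then v else 0)"
  using va[unfolded vertex_algebra_def, THEN conjunct2, THEN conjunct2, THEN conjunct2,
      THEN conjunct2, THEN conjunct2, THEN conjunct2, THEN conjunct2, THEN conjunct1] by blast

lemma Y_vac_right: "u \<in> S \<Longrightarrow> Y u (-1) vac = u"
  using va[unfolded vertex_algebra_def, THEN conjunct2, THEN conjunct2, THEN conjunct2,
      THEN conjunct2, THEN conjunct2, THEN conjunct2, THEN conjunct2, THEN conjunct2,
      THEN conjunct1] by blast

lemma Y_vac_right_nonneg: "u \<in> S \<Longrightarrow> n \<ge> 0 \<Longrightarrow> Y u n vac = 0"
  using va[unfolded vertex_algebra_def, THEN conjunct2, THEN conjunct2, THEN conjunct2,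
      THEN conjunct2, THEN conjunct2, THEN conjunct2, THEN conjunct2, THEN conjunct2,
      THEN conjunct1] by blast

text \<open>Phrased with \<open>eventually\<close>, so that the truncations of several pairs combine
  into one bound.\<close>

lemma truncation:
  assumes "u \<in> S" "v \<in> S"
  shows "eventually (\<lambda>i. Y u (r + int i) v = 0) sequentially"
proof -
  obtain N where N: "\<And>n. n \<ge> N \<Longrightarrow> Y u n v = 0"
    using va[unfolded vertex_algebra_def, THEN conjunct2, THEN conjunct2, THEN conjunct2,
      THEN conjunct2, THEN conjunct2, THEN conjunct2, THEN conjunct1] assms by blast
  show ?thesis unfolding eventually_sequentially
    by (rule exI[of _ "nat (N - r)"]) (auto intro: N)
qed

lemma borcherds_identity:
  assumes "u \<in> S" "v \<in> S" "w \<in> S"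
    and "\<And>i. i \<ge> N \<Longrightarrow> Y u (r + int i) v = 0"
    and "\<And>i. i \<ge> N \<Longrightarrow> Y v (q + int i) w = 0"
    and "\<And>i. i \<ge> N \<Longrightarrow> Y u (p + int i) w = 0"
  shows "(\<Sum>i<N. sc (ibin p i) (Y (Y u (r + int i) v) (p + q - int i) w)) =
       (\<Sum>i<N. sc ((-1) ^ i * ibin r i)
           (Y u (p + r - int i) (Y v (q + int i) w)
            - sc (isign r) (Y v (q + r - int i) (Y u (p + int i) w))))"
  using va[unfolded vertex_algebra_def, THEN conjunct2, THEN conjunct2, THEN conjunct2,
      THEN conjunct2, THEN conjunct2, THEN conjunct2, THEN conjunct2, THEN conjunct2,
      THEN conjunct2, unfolded borcherds_def, rule_format, OF assms(1-3), of N r q p] assms(4-6)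
  by simp

text \<open>One bound serves all three pairs. \<open>N \<ge> M\<close> allows comparison with a
  truncation already known, and \<open>N \<ge> 1\<close> keeps the term with index 0 in the
  sums.\<close>

lemma cutoff:
  assumes "u \<in> S" "v \<in> S" "w \<in> S"
  obtains N where "N \<ge> M" "N \<ge> 1"
    and "\<And>i. i \<ge> N \<Longrightarrow> Y u (r + int i) v = 0"
    and "\<And>i. i \<ge> N \<Longrightarrow> Y v (q + int i) w = 0"
    and "\<And>i. i \<ge> N \<Longrightarrow> Y u (p + int i) w = 0"
proof -
  have "eventually (\<lambda>i. Y u (r + int i) v = 0 \<and> Y v (q + int i) w = 0 \<and> Y u (p + int i) w = 0)
      sequentially"
    using assms by (intro eventually_conj truncation)
  then obtain N where "\<And>i. i \<ge> N \<Longrightarrow>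
      Y u (r + int i) v = 0 \<and> Y v (q + int i) w = 0 \<and> Y u (p + int i) w = 0"
    unfolding eventually_sequentially by blast
  then show ?thesis by (intro that[of "max N (max M 1)"]) auto
qed

section \<open>Commutator, associator and skew-symmetry formulas\<close>

lemma commutator:
  assumes "u \<in> S" "v \<in> S" "w \<in> S"
    and M: "\<And>i. i \<ge> M \<Longrightarrow> Y u (int i) v = 0"
  shows "Y u p (Y v q w) = Y v q (Y u p w)
           + (\<Sum>i<M. sc (ibin p i) (Y (Y u (int i) v) (p + q - int i) w))"
proof -
  obtain N where N: "N \<ge> M" "N \<ge> 1"
    and c: "\<And>i. i \<ge> N \<Longrightarrow> Y u (0 + int i) v = 0" "\<And>i. i \<ge> N \<Longrightarrow> Y v (q + int i) w = 0"
           "\<And>i. i \<ge> N \<Longrightarrow> Y u (p + int i) w = 0"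
    using cutoff[OF assms(1-3), of M 0 q p] by metis
  \<comment> \<open>With \<open>r = 0\<close> the coefficients \<open>ibin r i\<close> leave only
    the term \<open>i = 0\<close> on the right of the Borcherds identity.\<close>
  have "(\<Sum>i<N. sc (ibin p i) (Y (Y u (0 + int i) v) (p + q - int i) w)) =
      Y u p (Y v q w) - Y v q (Y u p w)"
    using N(2) by (subst borcherds_identity[OF assms(1-3) c], simp, subst sum_lessThan_only_zero)
       (auto simp: ibin_zero isign_def)
  moreover have "(\<Sum>i<N. sc (ibin p i) (Y (Y u (0 + int i) v) (p + q - int i) w)) =
      (\<Sum>i<M. sc (ibin p i) (Y (Y u (int i) v) (p + q - int i) w))"
    using sum_lessThan_extend[OF N(1),
        of "\<lambda>i. sc (ibin p i) (Y (Y u (0 + int i) v) (p + q - int i) w)"] M assms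
    by simp
  ultimately show ?thesis by (simp add: algebra_simps)
qed

text \<open>The case \<open>p = 0\<close>, where the left side of the Borcherds identity collapses
  to one term. The bound \<open>N\<close> stays explicit so that two structures can be expanded with
  the same one.\<close>

lemma associator:
  assumes "u \<in> S" "v \<in> S" "w \<in> S" "N \<ge> 1"
    and "\<And>i. i \<ge> N \<Longrightarrow> Y u (r + int i) v = 0"
    and "\<And>i. i \<ge> N \<Longrightarrow> Y v (q + int i) w = 0"
    and "\<And>i. i \<ge> N \<Longrightarrow> Y u (int i) w = 0"
  shows "Y (Y u r v) q w = (\<Sum>i<N. sc ((-1) ^ i * ibin r i)
           (Y u (r - int i) (Y v (q + int i) w) - sc (isign r) (Y v (q + r - int i) (Y u (int i) w))))"
proof -
  have "(\<Sum>i<N. sc (ibin 0 i) (Y (Y u (r + int i) v) (0 + q - int i) w)) = Y (Y u r v) q w"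
    by (subst sum_lessThan_only_zero) (use assms in \<open>auto simp: ibin_zero\<close>)
  then show ?thesis using borcherds_identity[of u v w N r q 0] assms by simp
qed

text \<open>The case \<open>p = -1\<close>, \<open>q = 0\<close>, \<open>w = vac\<close>: creation
  leaves a single term on the right. The vectors \<open>Y x (-1 - int i) vac\<close> are the divided
  powers of the translation operator applied to \<open>x\<close>.\<close>

lemma skew_symmetry:
  assumes "u \<in> S" "v \<in> S"
    and M: "\<And>i. i \<ge> M \<Longrightarrow> Y u (r + int i) v = 0"
  shows "sc (isign r) (Y v r u) = - (\<Sum>i<M. sc ((-1) ^ i) (Y (Y u (r + int i) v) (-1 - int i) vac))"
proof -
  obtain N where N: "N \<ge> M" "N \<ge> 1"
    and c: "\<And>i. i \<ge> N \<Longrightarrow> Y u (r + int i) v = 0" "\<And>i. i \<ge> N \<Longrightarrow> Y v (0 + int i) vac = 0"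
           "\<And>i. i \<ge> N \<Longrightarrow> Y u (-1 + int i) vac = 0"
    using cutoff[OF assms(1,2) vac_in, of M r 0 "-1"] by metis
  have v0: "Y v (int i) vac = 0" for i using Y_vac_right_nonneg assms by simp
  have u0: "Y u (-1 + int i) vac = 0" if "i \<noteq> 0" for i
    using Y_vac_right_nonneg assms that by simp
  have "(\<Sum>i<N. sc (ibin (-1) i) (Y (Y u (r + int i) v) (-1 + 0 - int i) vac)) =
      - sc (isign r) (Y v r u)"
    using N(2) assms v0 u0
    by (subst borcherds_identity[OF assms(1,2) vac_in c], simp, subst sum_lessThan_only_zero)
       (auto simp: Y_vac_right v0[of 0, simplified])
  moreover have "(\<Sum>i<N. sc (ibin (-1) i) (Y (Y u (r + int i) v) (-1 + 0 - int i) vac)) =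
      (\<Sum>i<M. sc ((-1) ^ i) (Y (Y u (r + int i) v) (-1 - int i) vac))"
    using sum_lessThan_extend[OF N(1),
        of "\<lambda>i. sc (ibin (-1) i) (Y (Y u (r + int i) v) (-1 + 0 - int i) vac)"] M
    by (simp add: ibin_minus_one)
  ultimately show ?thesis by (metis minus_minus)
qed

lemma isign_cancel: "sc (isign r) x = 0 \<Longrightarrow> x = 0"
  by (auto simp: isign_def split: if_splits)

text \<open>Skew-symmetry with an empty sum.\<close>

lemma commute_sym:
  assumes "u \<in> S" "v \<in> S" "\<And>n. n \<ge> 0 \<Longrightarrow> Y u n v = 0" "n \<ge> 0"
  shows "Y v n u = 0"
proof (rule isign_cancel[of n])
  have "Y u (n + int i) v = 0" for i using assms(3,4) by simp
  then show "sc (isign n) (Y v n u) = 0" using skew_symmetry[of u v 0 n] assms(1,2) by simp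
qed

section \<open>Subalgebras, commutants and double commutants\<close>

lemma vertex_subalgebraI:
  assumes "U \<subseteq> S" "subspace U" "vac \<in> U" "\<And>u v n. u \<in> U \<Longrightarrow> v \<in> U \<Longrightarrow> Y u n v \<in> U"
  shows "vertex_subalgebra sc Y vac S U"
  using assms unfolding vertex_subalgebra_def lin_subspace_def subspace_def by blast

lemma gen_subalg_subset: "vertex_subalgebra sc Y vac S U \<Longrightarrow> X \<subseteq> U \<Longrightarrow> gen_subalg sc Y vac S X \<subseteq> U"
  unfolding gen_subalg_def by blast

lemma gen_subalg_superset: "X \<subseteq> gen_subalg sc Y vac S X"
  unfolding gen_subalg_def by blast

lemma vertex_subalgebra_S: "vertex_subalgebra sc Y vac S S"
  by (rule vertex_subalgebraI) (auto simp: subspace_S Y_in)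

text \<open>By the commutator formula with no correction terms, a nonnegative mode of an element of
  \<open>X\<close> passes through \<open>Y u n\<close> and kills \<open>v\<close>.\<close>

lemma vertex_subalgebra_commutant:
  assumes "X \<subseteq> S"
  shows "vertex_subalgebra sc Y vac S (commutant Y S X)"
proof (rule vertex_subalgebraI)
  show "subspace (commutant Y S X)"
    using assms unfolding subspace_def commutant_def
    by (auto simp: add_in sc_in Y_add_right Y_sc_right subset_iff)
  show "vac \<in> commutant Y S X"
    using assms by (auto simp: commutant_def Y_vac_right_nonneg)
  show "Y u n v \<in> commutant Y S X" if "u \<in> commutant Y S X" "v \<in> commutant Y S X" for u v n
  proof -
    have "Y x m (Y u n v) = 0" if "x \<in> X" "m \<ge> 0" for x m
      using commutator[of x u v 0 m n] that assms \<open>u \<in> _\<close> \<open>v \<in> _\<close>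
      by (auto simp: commutant_def)
    then show ?thesis using that by (auto simp: commutant_def Y_in)
  qed
qed (auto simp: commutant_def)

text \<open>The commutant of \<open>v\<close> is a subalgebra containing \<open>x\<close>, hence
  contains what \<open>x\<close> generates; \<open>commute_sym\<close> switches sides before and
  after.\<close>

lemma commutant_gen_subalg_singletonI:
  assumes "x \<in> S" "v \<in> S" "\<And>n. n \<ge> 0 \<Longrightarrow> Y x n v = 0"
  shows "v \<in> commutant Y S (gen_subalg sc Y vac S {x})"
proof -
  have "gen_subalg sc Y vac S {x} \<subseteq> commutant Y S {v}"
    using assms commute_sym[of x v]
    by (intro gen_subalg_subset vertex_subalgebra_commutant) (auto simp: commutant_def)
  then show ?thesis using assms commute_sym[of v] by (auto simp: commutant_def subset_iff)
qed

lemma dcomm_commutes: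
  assumes "x \<in> S" "y \<in> S" "\<And>n. n \<ge> 0 \<Longrightarrow> Y x n y = 0" "v \<in> dcomm sc Y vac S x" "n \<ge> 0"
  shows "Y y n v = 0"
  using commutant_gen_subalg_singletonI[OF assms(1-3)] assms(4,5)
  unfolding dcomm_def commutant_def by blast

lemma dcomm_subset: "dcomm sc Y vac S x \<subseteq> S"
  unfolding dcomm_def commutant_def by blast

lemma self_in_dcomm:
  assumes "x \<in> S"
  shows "x \<in> dcomm sc Y vac S x"
proof -
  have "x \<in> gen_subalg sc Y vac S {x}" using gen_subalg_superset[of "{x}"] by blast
  then show ?thesis using assms commute_sym[of x]
    unfolding dcomm_def commutant_def by blast
qed

text \<open>First \<open>u\<close> commutes with \<open>y\<close>, so \<open>u\<close> lies in the
  commutant of the subalgebra generated by \<open>y\<close>, which \<open>v\<close> in turn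
  centralises.\<close>

lemma dcomm_commute_dcomm:
  assumes "x \<in> S" "y \<in> S" "\<And>n. n \<ge> 0 \<Longrightarrow> Y x n y = 0"
    "u \<in> dcomm sc Y vac S x" "v \<in> dcomm sc Y vac S y" "n \<ge> 0"
  shows "Y u n v = 0"
proof -
  have "u \<in> S" "v \<in> S" using assms dcomm_subset by blast+
  have "u \<in> commutant Y S (gen_subalg sc Y vac S {y})"
    using dcomm_commutes[OF assms(1-4)] \<open>u \<in> S\<close> assms(2)
    by (intro commutant_gen_subalg_singletonI)
  then show ?thesis using assms(5,6) unfolding dcomm_def commutant_def by blast
qed

end

section \<open>The Fock space\<close>

interpretation fock: vector_space fock_sc
  by unfold_locales (auto simp: fock_sc_def fun_eq_iff algebra_simps)

lemma fock_subspace: "fock.subspace (Fock d)"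
  unfolding fock.subspace_def
proof (intro conjI ballI allI)
  fix f g assume "f \<in> Fock d" "g \<in> Fock d"
  moreover have "{m. (f + g) m \<noteq> 0} \<subseteq> {m. f m \<noteq> 0} \<union> {m. g m \<noteq> 0}" by auto
  ultimately show "f + g \<in> Fock d" unfolding Fock_def
    by (auto intro: finite_subset)
next
  fix c f assume "f \<in> Fock d"
  moreover have "{m. fock_sc c f m \<noteq> 0} \<subseteq> {m. f m \<noteq> 0}" by (auto simp: fock_sc_def)
  ultimately show "fock_sc c f \<in> Fock d" unfolding Fock_def
    by (auto intro: finite_subset simp: fock_sc_def)
qed (simp add: Fock_def)

text \<open>Multiplication of a monomial by the variable \<open>k\<close>.\<close>

definition hincr :: "nat \<times> nat \<Rightarrow> hmono \<Rightarrow> hmono" where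
  "hincr k m = m(k := Suc (m k))"

text \<open>Polynomial degree, not conformal weight: a variable h_i(-n) counts 1 whatever
  \<open>n\<close> is.\<close>

definition hdeg :: "hmono \<Rightarrow> nat" where
  "hdeg m = sum m {k. m k \<noteq> 0}"

definition hmonom :: "hmono \<Rightarrow> hstate" where
  "hmonom m = (\<lambda>m'. if m' = m then 1 else 0)"

lemma fock_vac_eq: "fock_vac = hmonom (\<lambda>_. 0)"
  by (simp add: fock_vac_def hmonom_def)

lemma inj_hincr: "inj (hincr k)"
proof (rule injI)
  fix m m' assume "hincr k m = hincr k m'"
  then have eq: "hincr k m l = hincr k m' l" for l by simp
  show "m = m'"
  proof
    fix l show "m l = m' l" using eq[of l] by (cases "l = k") (auto simp: hincr_def)
  qed
qed

lemma hincr_neq_zero [simp]: "hincr k m \<noteq> (\<lambda>_. 0)"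
  by (metis hincr_def fun_upd_same nat.distinct(1))

lemma finite_supp_hincr: "finite {l. hincr k m l \<noteq> 0} \<longleftrightarrow> finite {l. m l \<noteq> 0}"
proof -
  have "{l. hincr k m l \<noteq> 0} = insert k {l. m l \<noteq> 0}" by (auto simp: hincr_def)
  then show ?thesis by simp
qed

lemma hdeg_hincr:
  assumes "finite {l. m l \<noteq> 0}"
  shows "hdeg (hincr k m) = Suc (hdeg m)"
proof -
  let ?A = "insert k {l. m l \<noteq> 0}"
  have "{l. hincr k m l \<noteq> 0} = ?A" by (auto simp: hincr_def)
  then have "hdeg (hincr k m) = sum (hincr k m) ?A" unfolding hdeg_def by simp
  also have "\<dots> = Suc (m k) + sum (hincr k m) (?A - {k})"
    using assms by (subst sum.remove[of _ k]) (auto simp: hincr_def)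
  also have "sum (hincr k m) (?A - {k}) = sum m (?A - {k})"
    by (rule sum.cong) (auto simp: hincr_def)
  also have "Suc (m k) + sum m (?A - {k}) = Suc (sum m ?A)"
    using assms by (subst (2) sum.remove[of _ k]) auto
  also have "sum m ?A = hdeg m"
    unfolding hdeg_def using assms by (intro sum.mono_neutral_right) auto
  finally show ?thesis .
qed

lemma hmono_ok_hincr: "hmono_ok d (hincr (i, n) m) \<longleftrightarrow> i < d \<and> 1 \<le> n \<and> hmono_ok d m"
  unfolding hmono_ok_def finite_supp_hincr by (auto simp: hincr_def)

lemma hmono_cases:
  obtains "m = (\<lambda>_. 0)" | k m' where "m = hincr k m'"
proof (cases "m = (\<lambda>_. 0)")
  case False
  then obtain k where "m k \<noteq> 0" by blast
  then have "m = hincr k (m(k := m k - 1))" by (auto simp: hincr_def fun_eq_iff)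
  then show ?thesis using that by blast
qed (use that in blast)

lemma hmono_ok_induct [consumes 1, case_names zero incr]:
  assumes "hmono_ok d m" "P (\<lambda>_. 0)"
    "\<And>i n m. i < d \<Longrightarrow> 1 \<le> n \<Longrightarrow> hmono_ok d m \<Longrightarrow> P m \<Longrightarrow> P (hincr (i, n) m)"
  shows "P m"
  using assms(1)
proof (induction "hdeg m" arbitrary: m rule: less_induct)
  case less
  show ?case
  proof (cases m rule: hmono_cases)
    case (2 k m')
    obtain i n where k: "k = (i, n)" by fastforce
    have ok: "i < d" "1 \<le> n" "hmono_ok d m'"
      using less.prems hmono_ok_hincr unfolding 2 k by auto
    then have "hdeg m' < hdeg m" unfolding 2 by (simp add: hdeg_hincr hmono_ok_def)
    with less.hyps ok show ?thesis unfolding 2 k by (intro assms(3)) auto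
  qed (use assms(2) in simp)
qed

lemma xmul_hincr: "xmul k f (hincr k m) = f m"
  by (simp add: xmul_def hincr_def)

lemma xmul_outside: "m \<notin> range (hincr k) \<Longrightarrow> xmul k f m = 0"
proof (rule ccontr)
  assume "m \<notin> range (hincr k)" "xmul k f m \<noteq> 0"
  then have "m k > 0" by (auto simp: xmul_def split: if_splits)
  then have "m = hincr k (m(k := m k - 1))" by (auto simp: hincr_def fun_eq_iff)
  then show False using \<open>m \<notin> range (hincr k)\<close> by blast
qed

lemma supp_xmul: "{m. xmul k f m \<noteq> 0} = hincr k ` {m. f m \<noteq> 0}"
proof (intro set_eqI iffI)
  fix m assume "m \<in> {m. xmul k f m \<noteq> 0}"
  moreover from this obtain m' where "m = hincr k m'" using xmul_outside[of m k f] by auto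
  ultimately show "m \<in> hincr k ` {m. f m \<noteq> 0}" by (auto simp: xmul_hincr)
qed (auto simp: xmul_hincr)

lemma xder_apply: "xder k f m = of_nat (Suc (m k)) * f (hincr k m)"
  by (simp add: xder_def hincr_def)

lemma xmul_in: "f \<in> Fock d \<Longrightarrow> i < d \<Longrightarrow> 1 \<le> n \<Longrightarrow> xmul (i, n) f \<in> Fock d"
proof -
  assume a: "f \<in> Fock d" "i < d" "1 \<le> n"
  have "hmono_ok d m" if "xmul (i, n) f m \<noteq> 0" for m
  proof -
    have "m \<in> hincr (i, n) ` {m. f m \<noteq> 0}" using supp_xmul that by blast
    then show ?thesis using a by (auto simp: hmono_ok_hincr Fock_def)
  qed
  then show ?thesis using a by (simp add: Fock_def supp_xmul)
qed

lemma xder_in: "f \<in> Fock d \<Longrightarrow> xder (i, n) f \<in> Fock d"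
proof -
  assume a: "f \<in> Fock d"
  have "{m. xder (i, n) f m \<noteq> 0} \<subseteq> hincr (i, n) -` {m. f m \<noteq> 0}" by (auto simp: xder_apply)
  moreover have "finite (hincr (i, n) -` {m. f m \<noteq> 0})"
    using a inj_hincr by (intro finite_vimageI) (auto simp: Fock_def)
  ultimately show ?thesis using a unfolding Fock_def
    by (auto simp: xder_apply hmono_ok_hincr dest: finite_subset)
qed

lemma hmode_in: "f \<in> Fock d \<Longrightarrow> i < d \<Longrightarrow> hmode i n f \<in> Fock d"
  using fock.subspace_scale[OF fock_subspace] fock.subspace_0[OF fock_subspace]
  by (auto simp: hmode_def xmul_in xder_in)

lemma fock_vac_in: "fock_vac \<in> Fock d"
  by (auto simp: Fock_def fock_vac_def hmono_ok_def)

lemma xmul_hmonom: "xmul k (hmonom m) = hmonom (hincr k m)"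
proof
  fix m'
  show "xmul k (hmonom m) m' = hmonom (hincr k m) m'"
  proof (cases "m' \<in> range (hincr k)")
    case True
    then show ?thesis using inj_hincr[of k] by (auto simp: xmul_hincr hmonom_def inj_def)
  next
    case False
    then have "xmul k (hmonom m) m' = 0" by (rule xmul_outside)
    with False show ?thesis by (auto simp: hmonom_def)
  qed
qed

lemma sum_fun_apply: "(\<Sum>x\<in>A. f x) y = (\<Sum>x\<in>A. f x y)"
  by (induction A rule: infinite_finite_induct) auto

lemma fock_decomp:
  assumes "f \<in> Fock d"
  shows "f = (\<Sum>m | f m \<noteq> 0. fock_sc (f m) (hmonom m))"
proof
  fix m
  have "finite {m. f m \<noteq> 0}" using assms by (simp add: Fock_def)
  then show "f m = (\<Sum>m | f m \<noteq> 0. fock_sc (f m) (hmonom m)) m"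
    by (simp add: sum_fun_apply fock_sc_def hmonom_def if_distrib cong: if_cong)
qed

text \<open>A state is a finite combination of monomials, and finitely many multiplications lead
  from the vacuum to each of them, so multiplication by a variable is the only nonlinear step to
  check.\<close>

lemma Fock_induct [consumes 1, case_names vac add scale xmul]:
  assumes "f \<in> Fock d" and vac: "P fock_vac"
    and add: "\<And>f g. f \<in> Fock d \<Longrightarrow> g \<in> Fock d \<Longrightarrow> P f \<Longrightarrow> P g \<Longrightarrow> P (f + g)"
    and scale: "\<And>c f. f \<in> Fock d \<Longrightarrow> P f \<Longrightarrow> P (fock_sc c f)"
    and xmul: "\<And>i n f. i < d \<Longrightarrow> 1 \<le> n \<Longrightarrow> f \<in> Fock d \<Longrightarrow> P f \<Longrightarrow> P (xmul (i, n) f)"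
  shows "P f"
proof -
  have monom: "hmonom m \<in> Fock d \<and> P (hmonom m)" if "hmono_ok d m" for m
    using that
  proof (induction rule: hmono_ok_induct)
    case zero
    then show ?case using vac fock_vac_in[of d] by (simp add: fock_vac_eq)
  next
    case (incr i n m)
    then show ?case using xmul[of i n "hmonom m"] xmul_in[of "hmonom m" d i n]
      by (simp add: xmul_hmonom)
  qed
  have "(\<Sum>m\<in>K. fock_sc (c m) (hmonom m)) \<in> Fock d \<and> P (\<Sum>m\<in>K. fock_sc (c m) (hmonom m))"
    if "finite K" "\<And>m. m \<in> K \<Longrightarrow> hmono_ok d m" for K c
    using that
  proof (induction K rule: finite_induct)
    case empty
    \<comment> \<open>The zero state is reached as 0 times the vacuum.\<close>
    then show ?case using scale[of fock_vac 0] vac fock_vac_in[of d] fock.subspace_0[OF fock_subspace]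
      by (simp del: zero_fun_apply)
  next
    case (insert m K)
    then show ?case
      using add[of "fock_sc (c m) (hmonom m)"] scale[of "hmonom m"] monom[of m]
        fock.subspace_add[OF fock_subspace] fock.subspace_scale[OF fock_subspace, of "hmonom m" d]
      by (simp del: plus_fun_apply)
  qed
  from this[of "{m. f m \<noteq> 0}" f] show ?thesis
    using fock_decomp[OF assms(1)] assms(1) by (simp add: Fock_def)
qed

lemma xder_fock_vac: "xder k fock_vac = 0"
  by (rule ext) (simp add: xder_apply fock_vac_def)

lemma xder_add: "xder k (f + g) = xder k f + xder k g"
  by (simp add: fun_eq_iff xder_def algebra_simps)

lemma xder_scale: "xder k (fock_sc c f) = fock_sc c (xder k f)"
  by (simp add: fun_eq_iff xder_def fock_sc_def)

text \<open>The canonical commutation relation, from which the Heisenberg relations on the Fock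
  space come.\<close>

lemma xder_xmul: "xder k (xmul l f) = (if k = l then f else 0) + xmul l (xder k f)"
proof
  fix m
  show "xder k (xmul l f) m = ((if k = l then f else 0) + xmul l (xder k f)) m"
  proof (cases "k = l")
    case True
    then show ?thesis
      by (cases "m k") (auto simp: xder_def xmul_def algebra_simps fun_upd_idem)
  next
    case False
    then show ?thesis by (auto simp: xder_def xmul_def fun_upd_twist)
  qed
qed

lemma xmul_zero: "xmul k 0 = 0"
  by (simp add: xmul_def fun_eq_iff)

lemma xmul_scale: "xmul k (fock_sc c f) = fock_sc c (xmul k f)"
  by (simp add: xmul_def fock_sc_def fun_eq_iff)

lemma xmul_add: "xmul k (f + g) = xmul k f + xmul k g"
  by (simp add: xmul_def fun_eq_iff)

lemma hmode_add: "hmode i n (f + g) = hmode i n f + hmode i n g"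
  by (simp add: hmode_def xmul_add xder_add fock.scale_right_distrib)

lemma hmode_scale: "hmode i n (fock_sc c f) = fock_sc c (hmode i n f)"
  by (simp add: hmode_def xmul_scale xder_scale mult.commute)

lemma hmode_fock_vac: "n \<ge> 0 \<Longrightarrow> hmode i n fock_vac = 0"
  by (simp add: hmode_def xder_fock_vac)

lemma hmode_xmul:
  "1 \<le> m \<Longrightarrow> n \<ge> 0 \<Longrightarrow> hmode i n (xmul (j, m) f) =
     (if i = j \<and> n = int m then fock_sc (of_int n) f else 0) + xmul (j, m) (hmode i n f)"
  by (auto simp: hmode_def xder_xmul xmul_zero xmul_scale fock.scale_right_distrib)

text \<open>A nonconstant monomial is divisible by some variable, and differentiating in that
  variable multiplies its coefficient by a positive integer.\<close>

lemma xder_zero_imp_constant: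
  assumes "f \<in> Fock d" "\<And>i n. i < d \<Longrightarrow> 1 \<le> n \<Longrightarrow> xder (i, n) f = 0"
  shows "f = fock_sc (f (\<lambda>_. 0)) fock_vac"
proof
  fix m
  show "f m = fock_sc (f (\<lambda>_. 0)) fock_vac m"
  proof (cases m rule: hmono_cases)
    case (2 k m')
    obtain i n where k: "k = (i, n)" by fastforce
    have "m \<noteq> (\<lambda>_. 0)" unfolding 2 by simp
    moreover have "f m = 0"
    proof (rule ccontr)
      assume "f m \<noteq> 0"
      then have "hmono_ok d m" using assms(1) by (simp add: Fock_def)
      then have "xder k f m' = 0" using assms(2) hmono_ok_hincr unfolding 2 k by simp
      then have "f m = 0" unfolding 2 xder_apply using of_nat_neq_0 by (metis mult_eq_0_iff)
      then show False using \<open>f m \<noteq> 0\<close> by simp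
    qed
    ultimately show ?thesis by (simp add: fock_sc_def fock_vac_def)
  qed (simp add: fock_sc_def fock_vac_def)
qed

section \<open>Generation by modes, uniqueness and transport of structure\<close>

lemma (in vertex_alg) stable_subspace_eq_S:
  assumes gen: "gen_subalg sc Y vac S X = S" and "X \<subseteq> S"
    and W: "W \<subseteq> S" "subspace W" and "vac \<in> W"
    and stable: "\<And>x n w. x \<in> X \<Longrightarrow> w \<in> W \<Longrightarrow> Y x n w \<in> W"
  shows "W = S"
proof -
  \<comment> \<open>The vectors all of whose modes preserve \<open>W\<close> form a subalgebra by
    the associator formula, so they exhaust \<open>S\<close>; applying their modes of index -1 to
    the vacuum then puts \<open>S\<close> inside \<open>W\<close>.\<close>
  let ?A = "{u \<in> S. \<forall>n. \<forall>w\<in>W. Y u n w \<in> W}"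
  have "vertex_subalgebra sc Y vac S ?A"
  proof (rule vertex_subalgebraI)
    show "subspace ?A"
      using W subspace_0[OF W(2)] subspace_add[OF W(2)] subspace_scale[OF W(2)]
      unfolding subspace_def by (auto simp: add_in sc_in Y_add_left Y_sc_left subset_iff)
    show "vac \<in> ?A" using W subspace_0[OF W(2)] by (auto simp: Y_vac_left)
    fix u v n assume u: "u \<in> ?A" and v: "v \<in> ?A"
    have "Y (Y u n v) q w \<in> W" if "w \<in> W" for q w
    proof -
      have S: "u \<in> S" "v \<in> S" "w \<in> S" using u v that W by auto
      obtain N where N: "N \<ge> 1" "\<And>i. i \<ge> N \<Longrightarrow> Y u (n + int i) v = 0"
          "\<And>i. i \<ge> N \<Longrightarrow> Y v (q + int i) w = 0" "\<And>i. i \<ge> N \<Longrightarrow> Y u (0 + int i) w = 0"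
        using cutoff[OF S, of 0 n q 0] by metis
      show ?thesis
        using u v that
        by (subst associator[OF S N(1-3)])
           (auto simp: N(4)[simplified] intro!: subspace_sum[OF W(2)] subspace_scale[OF W(2)]
              subspace_diff[OF W(2)])
    qed
    then show "Y u n v \<in> ?A" using u v by (auto simp: Y_in)
  qed auto
  then have "S \<subseteq> ?A"
    using gen_subalg_subset[of ?A X] gen stable \<open>X \<subseteq> S\<close> by blast
  then have "Y u (-1) vac \<in> W" if "u \<in> S" for u using that \<open>vac \<in> W\<close> by auto
  then show ?thesis using W by (auto simp: Y_vac_right)
qed

text \<open>Induction on the left argument. The state \<open>xmul (i, n) f\<close> is the mode -n of
  a generator applied to \<open>f\<close>, so the associator formula expresses its modes through
  those of the generator and of \<open>f\<close>, where both structures agree.\<close>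

lemma fock_structure_unique:
  assumes Y1: "vertex_algebra fock_sc Y1 fock_vac (Fock d)"
      "\<And>u n v. u \<notin> Fock d \<or> v \<notin> Fock d \<Longrightarrow> Y1 u n v = 0"
      "\<And>i n f. i < d \<Longrightarrow> f \<in> Fock d \<Longrightarrow> Y1 (hmode i (-1) fock_vac) n f = hmode i n f"
    and Y2: "vertex_algebra fock_sc Y2 fock_vac (Fock d)"
      "\<And>u n v. u \<notin> Fock d \<or> v \<notin> Fock d \<Longrightarrow> Y2 u n v = 0"
      "\<And>i n f. i < d \<Longrightarrow> f \<in> Fock d \<Longrightarrow> Y2 (hmode i (-1) fock_vac) n f = hmode i n f"
  shows "Y1 = Y2"
proof -
  interpret V1: vertex_alg fock_sc Y1 fock_vac "Fock d" by unfold_locales (rule Y1)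
  interpret V2: vertex_alg fock_sc Y2 fock_vac "Fock d" by unfold_locales (rule Y2)
  have "\<forall>n. \<forall>v\<in>Fock d. Y1 u n v = Y2 u n v" if "u \<in> Fock d" for u
    using that
  proof (induction rule: Fock_induct)
    case vac
    then show ?case by (simp add: V1.Y_vac_left V2.Y_vac_left)
  next
    case (add f g)
    then show ?case by (simp add: V1.Y_add_left V2.Y_add_left del: plus_fun_apply)
  next
    case (scale c f)
    then show ?case by (simp add: V1.Y_sc_left V2.Y_sc_left)
  next
    case (xmul i n f)
    show ?case
    proof (intro allI ballI)
      fix q w assume w: "w \<in> Fock d"
      let ?h = "hmode i (-1) fock_vac" and ?r = "- int n"
      have h: "?h \<in> Fock d" using xmul fock_vac_in by (intro hmode_in)
      have S: "?h \<in> Fock d" "f \<in> Fock d" "w \<in> Fock d" using h xmul w by auto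
      obtain N where N: "N \<ge> 1" "\<And>i. i \<ge> N \<Longrightarrow> Y1 ?h (?r + int i) f = 0"
          "\<And>i. i \<ge> N \<Longrightarrow> Y1 f (q + int i) w = 0" "\<And>i. i \<ge> N \<Longrightarrow> Y1 ?h (0 + int i) w = 0"
        using V1.cutoff[OF S, of 0 ?r q 0] by metis
      have h_eq: "Y1 ?h k g = Y2 ?h k g" if "g \<in> Fock d" for k g
        using Y1(3) Y2(3) xmul that by simp
      have f_eq: "Y1 f k g = Y2 f k g" if "g \<in> Fock d" for k g
        using xmul that by simp
      \<comment> \<open>The bound chosen for \<open>Y1\<close> also truncates \<open>Y2\<close>,
        since the products involved coincide.\<close>
      have N2: "Y2 ?h (?r + int i) f = 0" "Y2 f (q + int i) w = 0" "Y2 ?h (int i) w = 0"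
        if "i \<ge> N" for i
        using N(2-4)[OF that] h_eq f_eq xmul w by auto
      let ?E = "\<lambda>Y. \<Sum>k<N. fock_sc ((-1) ^ k * ibin ?r k)
        (Y ?h (?r - int k) (Y f (q + int k) w)
         - fock_sc (isign ?r) (Y f (q + ?r - int k) (Y ?h (int k) w)))"
      have "Y1 (Y1 ?h ?r f) q w = ?E Y1"
        using N by (intro V1.associator S) auto
      also have "?E Y1 = ?E Y2"
        by (rule sum.cong) (simp_all add: h_eq f_eq V2.Y_in S)
      also have "?E Y2 = Y2 (Y2 ?h ?r f) q w"
        using N(1) N2 by (intro V2.associator[symmetric] S) auto
      finally have "Y1 (Y1 ?h ?r f) q w = Y2 (Y2 ?h ?r f) q w" .
      moreover have "xmul (i, n) f = Y1 ?h ?r f" "xmul (i, n) f = Y2 ?h ?r f"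
        using Y1(3)[OF xmul(1,3)] Y2(3)[OF xmul(1,3)] xmul by (auto simp: hmode_def)
      ultimately show "Y1 (xmul (i, n) f) q w = Y2 (xmul (i, n) f) q w" by simp
    qed
  qed
  then show ?thesis using Y1(2) Y2(2) by (metis ext)
qed

text \<open>Each identity is checked after applying the injective \<open>\<psi>\<close>; the
  vanishing conditions in the Borcherds identity carry over because \<open>\<psi>\<close> fixes
  0.\<close>

lemma vertex_algebra_transport:
  fixes sc :: "complex \<Rightarrow> 'v::ab_group_add \<Rightarrow> 'v" and sc' :: "complex \<Rightarrow> 'w::ab_group_add \<Rightarrow> 'w"
  assumes vs: "vector_space sc" "vector_space sc'"
    and va: "vertex_algebra sc Y vac S"
    and bij: "bij_betw \<psi> W S" and W: "lin_subspace sc' W" "vac' \<in> W" "\<psi> vac' = vac"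
    and add: "\<And>f g. f \<in> W \<Longrightarrow> g \<in> W \<Longrightarrow> \<psi> (f + g) = \<psi> f + \<psi> g"
    and scale: "\<And>c f. f \<in> W \<Longrightarrow> \<psi> (sc' c f) = sc c (\<psi> f)"
    and Y'_in: "\<And>u n v. u \<in> W \<Longrightarrow> v \<in> W \<Longrightarrow> Y' u n v \<in> W"
    and hom: "\<And>u n v. u \<in> W \<Longrightarrow> v \<in> W \<Longrightarrow> \<psi> (Y' u n v) = Y (\<psi> u) n (\<psi> v)"
  shows "vertex_algebra sc' Y' vac' W"
proof -
  interpret V: vertex_alg sc Y vac S
    using vs va by (simp add: vertex_alg_def vertex_alg_axioms_def)
  interpret W: vector_space sc' by (rule vs)
  have subW: "W.subspace W" using W by (auto simp: lin_subspace_def W.subspace_def)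
  note W_in = W.subspace_0[OF subW] W.subspace_add[OF subW] W.subspace_scale[OF subW]
    W.subspace_diff[OF subW] W.subspace_sum[OF subW]
  have inj: "f = g" if "\<psi> f = \<psi> g" "f \<in> W" "g \<in> W" for f g
    using bij that by (auto simp: bij_betw_def inj_on_def)
  have \<psi>_in: "\<psi> f \<in> S" if "f \<in> W" for f using bij that by (auto simp: bij_betw_def)
  have \<psi>0: "\<psi> 0 = 0" using scale[of 0 0] W_in by simp
  have \<psi>_eq0: "f = 0" if "\<psi> f = 0" "f \<in> W" for f using inj[of f 0] that \<psi>0 W_in by simp
  have diff: "\<psi> (f - g) = \<psi> f - \<psi> g" if "f \<in> W" "g \<in> W" for f g
    using add[of "f - g" g] W_in that by (simp add: algebra_simps)
  have \<psi>_sum: "\<psi> (sum F K) = (\<Sum>x\<in>K. \<psi> (F x))" if "\<And>x. x \<in> K \<Longrightarrow> F x \<in> W" for F :: "nat \<Rightarrow> 'w" and K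
    using that by (induction K rule: infinite_finite_induct) (auto simp: add W_in \<psi>0)
  have bor: "borcherds sc' Y' W"
    unfolding borcherds_def
  proof (intro ballI allI impI)
    fix u v w p q r N
    assume S: "u \<in> W" "v \<in> W" "w \<in> W"
      and z: "\<forall>i\<ge>N. Y' u (r + int i) v = 0 \<and> Y' v (q + int i) w = 0 \<and> Y' u (p + int i) w = 0"
    let ?L = "\<Sum>i<N. sc' (ibin p i) (Y' (Y' u (r + int i) v) (p + q - int i) w)"
    let ?R = "\<Sum>i<N. sc' ((-1) ^ i * ibin r i)
           (Y' u (p + r - int i) (Y' v (q + int i) w)
            - sc' (isign r) (Y' v (q + r - int i) (Y' u (p + int i) w)))"
    have z': "Y (\<psi> u) (r + int i) (\<psi> v) = 0" "Y (\<psi> v) (q + int i) (\<psi> w) = 0"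
      "Y (\<psi> u) (p + int i) (\<psi> w) = 0" if "i \<ge> N" for i
      using z that S hom \<psi>0 by metis+
    have "\<psi> ?L = \<psi> ?R"
      using V.borcherds_identity[OF \<psi>_in[OF S(1)] \<psi>_in[OF S(2)] \<psi>_in[OF S(3)] z']
      by (simp add: \<psi>_sum scale hom diff W_in Y'_in S)
    then show "?L = ?R" by (rule inj) (auto intro!: W_in Y'_in S)
  qed
  have trunc: "\<exists>N. \<forall>n\<ge>N. Y' u n v = 0" if "u \<in> W" "v \<in> W" for u v
  proof -
    obtain N where N: "\<And>i. i \<ge> N \<Longrightarrow> Y (\<psi> u) (0 + int i) (\<psi> v) = 0"
      using V.truncation[of "\<psi> u" "\<psi> v" 0] \<psi>_in \<open>u \<in> W\<close> \<open>v \<in> W\<close>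
      unfolding eventually_sequentially by blast
    have "Y' u n v = 0" if "n \<ge> int N" for n
      using N[of "nat n"] that \<open>u \<in> W\<close> \<open>v \<in> W\<close> by (intro \<psi>_eq0) (auto simp: hom Y'_in)
    then show ?thesis by blast
  qed
  show ?thesis
    unfolding vertex_algebra_def
  proof (intro conjI ballI allI impI bor trunc W Y'_in)
    show "Y' (u + u') n v = Y' u n v + Y' u' n v" if "u \<in> W" "u' \<in> W" "v \<in> W" for u u' n v
      using that by (intro inj) (auto simp: hom add V.Y_add_left \<psi>_in W_in Y'_in)
    show "Y' u n (v + v') = Y' u n v + Y' u n v'" if "u \<in> W" "v \<in> W" "v' \<in> W" for u v n v'
      using that by (intro inj) (auto simp: hom add V.Y_add_right \<psi>_in W_in Y'_in)
    show "Y' (sc' c u) n v = sc' c (Y' u n v)" if "u \<in> W" "v \<in> W" for c u n v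
      using that by (intro inj) (auto simp: hom scale V.Y_sc_left \<psi>_in W_in Y'_in)
    show "Y' u n (sc' c v) = sc' c (Y' u n v)" if "u \<in> W" "v \<in> W" for c u n v
      using that by (intro inj) (auto simp: hom scale V.Y_sc_right \<psi>_in W_in Y'_in)
    show "Y' vac' n v = (if n = -1 then v else 0)" if "v \<in> W" for n v
      using that by (intro inj) (auto simp: hom V.Y_vac_left \<psi>_in W_in Y'_in W \<psi>0)
    show "Y' u (-1) vac' = u" if "u \<in> W" for u
      using that by (intro inj) (auto simp: hom V.Y_vac_right \<psi>_in Y'_in W)
    show "Y' u n vac' = 0" if "u \<in> W" "n \<ge> 0" for u n
      using that by (intro \<psi>_eq0) (auto simp: hom V.Y_vac_right_nonneg \<psi>_in Y'_in W)
  qed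
qed

section \<open>Vertex algebras generated by Heisenberg fields\<close>

text \<open>The vectors \<open>h i\<close> stand for an orthonormal basis of weight one; their
  nonnegative products encode the level 1 Heisenberg relations.\<close>

locale heisenberg_va = vertex_alg +
  fixes d :: nat and h :: "nat \<Rightarrow> 'a"
  assumes h_in: "i < d \<Longrightarrow> h i \<in> S"
    and h_h: "i < d \<Longrightarrow> j < d \<Longrightarrow> n \<ge> 0 \<Longrightarrow> Y (h i) n (h j) = (if i = j \<and> n = 1 then vac else 0)"
    and vac_nonzero: "vac \<noteq> 0"
    and h_gen: "gen_subalg sc Y vac S (h ` {..<d}) = S"
begin

text \<open>Only the product of index 1 contributes: its binomial coefficient is \<open>m\<close>,
  and the vacuum mode \<open>m + n - 1\<close> is the identity exactly when
  \<open>m + n = 0\<close>.\<close>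

lemma heisenberg_commutator:
  assumes "i < d" "j < d" "w \<in> S"
  shows "Y (h i) m (Y (h j) n w) =
    Y (h j) n (Y (h i) m w) + (if i = j \<and> m + n = 0 then sc (of_int m) w else 0)"
proof -
  have "Y (h i) (int k) (h j) = 0" if "k \<ge> 2" for k using that h_h assms by simp
  then show ?thesis
    using commutator[of "h i" "h j" w 2 m n] h_in h_h[OF assms(1,2)] assms
    by (simp add: numeral_2_eq_2 ibin_def Y_vac_left add_eq_0_iff)
qed

text \<open>The identity outside \<open>S\<close>, so that the operators commute on the whole type and can be folded.\<close>

definition creation :: "nat \<times> nat \<Rightarrow> 'a \<Rightarrow> 'a" where
  "creation k v = (if v \<in> S \<and> fst k < d then Y (h (fst k)) (- int (snd k)) v else v)"

lemma creation_in: "v \<in> S \<Longrightarrow> creation k v \<in> S"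
  by (simp add: creation_def Y_in h_in)

text \<open>Both mode indices are nonpositive, so a central term could arise only if both were 0,
  and then its coefficient is 0.\<close>

sublocale creation: comp_fun_commute creation
proof
  fix k l
  show "creation k \<circ> creation l = creation l \<circ> creation k"
  proof
    fix v show "(creation k \<circ> creation l) v = (creation l \<circ> creation k) v"
      using heisenberg_commutator[of "fst k" "fst l" v "- int (snd k)" "- int (snd l)"]
      by (auto simp: creation_def Y_in h_in)
  qed
qed

text \<open>The product of creation operators applied to the vacuum; no order of factors is needed
  because they commute.\<close>

definition monomial :: "hmono \<Rightarrow> 'a" where
  "monomial m = Finite_Set.fold (\<lambda>k. creation k ^^ m k) vac {k. m k \<noteq> 0}"

lemma comp_fun_commute_creation_power: "comp_fun_commute (\<lambda>k. creation k ^^ m k)"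
  by (rule creation.comp_fun_commute_funpow)

text \<open>Variables with exponent 0 contribute identity operators. This lets monomials with
  different supports be folded over a common set.\<close>

lemma monomial_superset:
  assumes "finite A" "{k. m k \<noteq> 0} \<subseteq> A"
  shows "Finite_Set.fold (\<lambda>k. creation k ^^ m k) vac A = monomial m"
proof -
  interpret F: comp_fun_commute "\<lambda>k. creation k ^^ m k" by (rule comp_fun_commute_creation_power)
  have "Finite_Set.fold (\<lambda>k. creation k ^^ m k) vac ({k. m k \<noteq> 0} \<union> B) = monomial m"
    if "finite B" "\<And>k. k \<in> B \<Longrightarrow> m k = 0" for B
    using that
  proof (induction B rule: finite_induct)
    case (insert k B)
    have "finite {k. m k \<noteq> 0}" using assms finite_subset by blast
    then show ?case using insert by simp
  qed (simp add: monomial_def)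
  from this[of "A - {k. m k \<noteq> 0}"]
  have "Finite_Set.fold (\<lambda>k. creation k ^^ m k) vac ({k. m k \<noteq> 0} \<union> (A - {k. m k \<noteq> 0})) = monomial m"
    using assms(1) by blast
  moreover have "{k. m k \<noteq> 0} \<union> (A - {k. m k \<noteq> 0}) = A" using assms(2) by blast
  ultimately show ?thesis by (simp only:)
qed

lemma monomial_hincr:
  assumes "finite {k. m k \<noteq> 0}"
  shows "monomial (hincr k m) = creation k (monomial m)"
proof -
  let ?F = "\<lambda>m k. creation k ^^ m k"
  let ?A = "{l. m l \<noteq> 0} - {k}"
  have A: "finite ?A" using assms by simp
  \<comment> \<open>Isolates the factor for \<open>k\<close>; the remaining fold is the same for
    \<open>m\<close> and \<open>hincr k m\<close>.\<close>
  have *: "monomial m' = (creation k ^^ m' k) (Finite_Set.fold (?F m') vac ?A)"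
    if "{l. m' l \<noteq> 0} \<subseteq> insert k ?A" for m'
  proof -
    interpret F: comp_fun_commute "?F m'" by (rule comp_fun_commute_creation_power)
    show ?thesis
      using monomial_superset[of "insert k ?A" m'] that A F.fold_insert[OF A, of k vac] by simp
  qed
  have "Finite_Set.fold (?F (hincr k m)) vac ?A = Finite_Set.fold (?F m) vac ?A"
  proof (rule Finite_Set.fold_cong[where S = UNIV])
    show "comp_fun_commute_on UNIV (?F (hincr k m))" "comp_fun_commute_on UNIV (?F m)"
      using comp_fun_commute_creation_power by (simp_all add: comp_fun_commute_def')
  qed (use A in \<open>auto simp: hincr_def\<close>)
  moreover have "{l. hincr k m l \<noteq> 0} \<subseteq> insert k ?A" "{l. m l \<noteq> 0} \<subseteq> insert k ?A"
    by (auto simp: hincr_def)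
  moreover have "hincr k m k = Suc (m k)" by (simp add: hincr_def)
  ultimately show ?thesis using *[of "hincr k m"] *[of m] by simp
qed

lemma monomial_zero: "monomial (\<lambda>_. 0) = vac"
  by (simp add: monomial_def)

lemma monomial_in: "hmono_ok d m \<Longrightarrow> monomial m \<in> S"
  by (induction rule: hmono_ok_induct) (auto simp: monomial_zero monomial_hincr creation_in hmono_ok_def)

section \<open>The comparison map from the Fock space, whose inverse will be the isomorphism\<close>

definition fock_map :: "hstate \<Rightarrow> 'a" where
  "fock_map f = (\<Sum>m | f m \<noteq> 0. sc (f m) (monomial m))"

lemma fock_map_superset:
  "finite A \<Longrightarrow> {m. f m \<noteq> 0} \<subseteq> A \<Longrightarrow> fock_map f = (\<Sum>m\<in>A. sc (f m) (monomial m))"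
  unfolding fock_map_def by (rule sum.mono_neutral_left) auto

lemma fock_map_in: "f \<in> Fock d \<Longrightarrow> fock_map f \<in> S"
  unfolding fock_map_def by (rule sum_in) (auto simp: Fock_def intro!: sc_in monomial_in)

lemma fock_map_add:
  assumes "f \<in> Fock d" "g \<in> Fock d"
  shows "fock_map (f + g) = fock_map f + fock_map g"
proof -
  let ?A = "{m. f m \<noteq> 0} \<union> {m. g m \<noteq> 0}"
  have A: "finite ?A" using assms by (simp add: Fock_def)
  have "fock_map k = (\<Sum>m\<in>?A. sc (k m) (monomial m))" if "k \<in> {f, g, f + g}" for k
    using that by (intro fock_map_superset[OF A]) auto
  then show ?thesis by (simp add: scale_left_distrib sum.distrib)
qed

lemma fock_map_scale:
  assumes "f \<in> Fock d"
  shows "fock_map (fock_sc c f) = sc c (fock_map f)"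
proof -
  have "fock_map (fock_sc c f) = (\<Sum>m | f m \<noteq> 0. sc (fock_sc c f m) (monomial m))"
    using assms by (intro fock_map_superset) (auto simp: Fock_def fock_sc_def)
  then show ?thesis by (simp add: fock_map_def scale_sum_right fock_sc_def)
qed

lemma fock_map_vac: "fock_map fock_vac = vac"
proof -
  have "fock_map fock_vac = (\<Sum>m\<in>{\<lambda>_. 0}. sc (fock_vac m) (monomial m))"
    by (rule fock_map_superset) (auto simp: fock_vac_def)
  then show ?thesis by (simp add: fock_vac_def monomial_zero)
qed

lemma fock_map_zero: "fock_map 0 = 0"
  by (simp add: fock_map_def)

lemma fock_map_diff:
  "f \<in> Fock d \<Longrightarrow> g \<in> Fock d \<Longrightarrow> fock_map (f - g) = fock_map f - fock_map g"
  using fock_map_add[of "f - g" g] fock.subspace_diff[OF fock_subspace, of f d g]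
  by (simp add: algebra_simps)

lemma fock_map_xmul:
  assumes "f \<in> Fock d" "i < d"
  shows "fock_map (xmul (i, n) f) = Y (h i) (- int n) (fock_map f)"
proof -
  have fin: "hmono_ok d m" if "f m \<noteq> 0" for m using assms that by (simp add: Fock_def)
  have "fock_map (xmul (i, n) f) = (\<Sum>m | f m \<noteq> 0. sc (f m) (monomial (hincr (i, n) m)))"
    unfolding fock_map_def supp_xmul
    by (subst sum.reindex) (auto simp: xmul_hincr intro: inj_on_subset[OF inj_hincr])
  also have "\<dots> = (\<Sum>m | f m \<noteq> 0. Y (h i) (- int n) (sc (f m) (monomial m)))"
    using fin assms
    by (intro sum.cong) (auto simp: monomial_hincr hmono_ok_def creation_def monomial_in Y_sc_right h_in)
  also have "\<dots> = Y (h i) (- int n) (fock_map f)"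
    unfolding fock_map_def using fin assms by (intro Y_sum_right[symmetric]) (auto simp: h_in sc_in monomial_in)
  finally show ?thesis .
qed

text \<open>Negative modes correspond by the construction of monomials. Nonnegative modes kill both
  vacua and have the same commutators with the creation operators.\<close>

lemma fock_map_hmode:
  assumes "f \<in> Fock d" "i < d"
  shows "fock_map (hmode i n f) = Y (h i) n (fock_map f)"
proof (cases "n < 0")
  case True
  then show ?thesis using fock_map_xmul[OF assms, of "nat (- n)"] by (simp add: hmode_def)
next
  case False
  then have n: "n \<ge> 0" by simp
  show ?thesis using assms(1)
  proof (induction rule: Fock_induct)
    case vac
    then show ?case using n assms h_in
      by (simp add: hmode_fock_vac fock_map_vac Y_vac_right_nonneg fock_map_zero del: zero_fun_apply)
  next
    case (add f g)
    then show ?case using assms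
      by (simp add: hmode_add fock_map_add hmode_in Y_add_right h_in fock_map_in del: plus_fun_apply)
  next
    case (scale c f)
    then show ?case using assms by (simp add: hmode_scale fock_map_scale hmode_in Y_sc_right h_in fock_map_in)
  next
    case (xmul j m f)
    have in_Fock: "(if i = j \<and> n = int m then fock_sc (of_int n) f else 0) \<in> Fock d"
      using xmul fock.subspace_scale[OF fock_subspace] fock.subspace_0[OF fock_subspace] by simp
    have "fock_map (hmode i n (xmul (j, m) f)) =
        (if i = j \<and> n = int m then sc (of_int n) (fock_map f) else 0)
        + Y (h j) (- int m) (Y (h i) n (fock_map f))"
      using xmul assms n in_Fock
      by (simp add: hmode_xmul fock_map_add xmul_in hmode_in fock_map_xmul fock_map_scale
          fock_map_zero del: plus_fun_apply split del: if_split)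
         (simp add: fock_map_scale fock_map_zero)
    also have "\<dots> = Y (h i) n (fock_map (xmul (j, m) f))"
      using xmul assms heisenberg_commutator[of i j "fock_map f" n "- int m"]
      by (auto simp: fock_map_xmul fock_map_in)
    finally show ?case .
  qed
qed

text \<open>The mode \<open>n\<close> acts as \<open>n\<close> times the derivative, and
  \<open>n\<close> is invertible.\<close>

lemma fock_map_xder_zero:
  assumes "f \<in> Fock d" "i < d" "1 \<le> n" "Y (h i) (int n) (fock_map f) = 0"
  shows "fock_map (xder (i, n) f) = 0"
proof -
  have "sc (of_nat n) (fock_map (xder (i, n) f)) = Y (h i) (int n) (fock_map f)"
    using fock_map_hmode[OF assms(1,2), of "int n"] assms(3)
    by (simp add: hmode_def fock_map_scale xder_in[OF assms(1)])
  then show ?thesis using assms(3,4) by simp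
qed

text \<open>Differentiation lowers the degree and preserves the kernel, so a kernel element of minimal
  degree would be a constant.\<close>

lemma fock_map_kernel:
  assumes "f \<in> Fock d" "fock_map f = 0"
  shows "f = 0"
proof -
  have "f = 0" if "f \<in> Fock d" "fock_map f = 0" "\<And>m. f m \<noteq> 0 \<Longrightarrow> hdeg m < N" for f N
    using that
  proof (induction N arbitrary: f)
    case 0
    then show ?case by (auto simp: fun_eq_iff)
  next
    case (Suc N)
    have "xder (i, n) f = 0" if "i < d" "1 \<le> n" for i n
    proof (rule Suc.IH)
      show "xder (i, n) f \<in> Fock d" using Suc.prems by (intro xder_in)
      show "fock_map (xder (i, n) f) = 0"
        using Suc.prems that by (intro fock_map_xder_zero) (auto simp: h_in)
      fix m assume "xder (i, n) f m \<noteq> 0"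
      then have m: "f (hincr (i, n) m) \<noteq> 0" by (simp add: xder_apply)
      then have "hmono_ok d m" using Suc.prems(1) hmono_ok_hincr by (auto simp: Fock_def)
      then have "hdeg (hincr (i, n) m) = Suc (hdeg m)" by (intro hdeg_hincr) (simp add: hmono_ok_def)
      then show "hdeg m < N" using Suc.prems(3)[OF m] by simp
    qed
    then have f: "f = fock_sc (f (\<lambda>_. 0)) fock_vac"
      by (intro xder_zero_imp_constant[OF Suc.prems(1)])
    then have "sc (f (\<lambda>_. 0)) vac = 0"
      using Suc.prems(2) fock_map_scale[OF fock_vac_in, of "f (\<lambda>_. 0)"] by (simp add: fock_map_vac)
    then show ?case using f vac_nonzero by simp
  qed
  moreover have "hdeg m < Suc (Max (hdeg ` {m. f m \<noteq> 0}))" if "f m \<noteq> 0" for m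
    using assms(1) that by (auto simp: Fock_def less_Suc_eq_le intro!: Max_ge)
  ultimately show ?thesis using assms by blast
qed

lemma fock_map_bij: "bij_betw fock_map (Fock d) S"
proof -
  have "inj_on fock_map (Fock d)"
  proof (rule inj_onI)
    fix f g assume "f \<in> Fock d" "g \<in> Fock d" "fock_map f = fock_map g"
    then have "f - g = 0"
      using fock.subspace_diff[OF fock_subspace] fock_map_diff by (intro fock_map_kernel) auto
    then show "f = g" by simp
  qed
  moreover have "fock_map ` Fock d = S"
  \<comment> \<open>The image contains the vacuum and is stable under all modes of the generators,
    hence is everything.\<close>
  proof (rule stable_subspace_eq_S[OF h_gen])
    show "subspace (fock_map ` Fock d)"
      unfolding subspace_def
    proof (intro conjI ballI allI)
      show "0 \<in> fock_map ` Fock d"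
        using fock_map_zero fock.subspace_0[OF fock_subspace] by (metis imageI)
    next
      fix x y assume "x \<in> fock_map ` Fock d" "y \<in> fock_map ` Fock d"
      then show "x + y \<in> fock_map ` Fock d"
        using fock_map_add fock.subspace_add[OF fock_subspace] by (auto simp: image_iff) metis
    next
      fix c x assume "x \<in> fock_map ` Fock d"
      then show "sc c x \<in> fock_map ` Fock d"
        using fock_map_scale fock.subspace_scale[OF fock_subspace] by (auto simp: image_iff) metis
    qed
    show "vac \<in> fock_map ` Fock d" using fock_map_vac fock_vac_in by (metis imageI)
    show "Y x n w \<in> fock_map ` Fock d" if "x \<in> h ` {..<d}" "w \<in> fock_map ` Fock d" for x n w
      using that fock_map_hmode hmode_in by (auto simp: image_iff) metis
  qed (auto simp: h_in fock_map_in)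
  ultimately show ?thesis by (simp add: bij_betw_def)
qed

section \<open>The vertex algebra structure on the Fock space\<close>

definition fockY :: "hstate \<Rightarrow> int \<Rightarrow> hstate \<Rightarrow> hstate" where
  "fockY u n v = (if u \<in> Fock d \<and> v \<in> Fock d
     then inv_into (Fock d) fock_map (Y (fock_map u) n (fock_map v)) else 0)"

lemma fock_map_inv: "x \<in> S \<Longrightarrow> fock_map (inv_into (Fock d) fock_map x) = x"
  using fock_map_bij by (simp add: bij_betw_def f_inv_into_f)

lemma inv_fock_map: "f \<in> Fock d \<Longrightarrow> inv_into (Fock d) fock_map (fock_map f) = f"
  using fock_map_bij by (simp add: bij_betw_def)

lemma inv_fock_map_in: "x \<in> S \<Longrightarrow> inv_into (Fock d) fock_map x \<in> Fock d"
  using fock_map_bij by (metis bij_betw_def inv_into_into)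

lemma fock_map_fockY:
  "u \<in> Fock d \<Longrightarrow> v \<in> Fock d \<Longrightarrow> fock_map (fockY u n v) = Y (fock_map u) n (fock_map v)"
  by (simp add: fockY_def fock_map_inv Y_in fock_map_in)

lemma fock_map_generator: "i < d \<Longrightarrow> fock_map (hmode i (-1) fock_vac) = h i"
  by (simp add: fock_map_hmode fock_vac_in fock_map_vac Y_vac_right h_in)

text \<open>The definite description is resolved by transport along \<open>fock_map\<close> for
  existence and by \<open>fock_structure_unique\<close> for uniqueness. The default value 0 in
  \<open>fockY\<close> matches the normalisation outside the carrier.\<close>

lemma heisY_eq_fockY: "heisY d = fockY"
  unfolding heisY_def
proof (rule the_equality)
  have va': "vertex_algebra fock_sc fockY fock_vac (Fock d)"
  proof (rule vertex_algebra_transport[OF _ _ va fock_map_bij])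
    show "lin_subspace fock_sc (Fock d)"
      using fock_subspace[of d] by (simp add: lin_subspace_def fock.subspace_def)
    show "fockY u n v \<in> Fock d" if "u \<in> Fock d" "v \<in> Fock d" for u n v
      using that by (simp add: fockY_def inv_fock_map_in Y_in fock_map_in)
  qed (auto simp: fock_vac_in fock_map_vac fock_map_add fock_map_scale fock_map_fockY
         fock.vector_space_axioms vector_space_axioms)
  have gens: "fockY (hmode i (-1) fock_vac) n f = hmode i n f" if "i < d" "f \<in> Fock d" for i n f
    using that inv_fock_map[of "hmode i n f"]
    by (simp add: fockY_def hmode_in fock_vac_in fock_map_generator fock_map_hmode[of f])
  show "vertex_algebra fock_sc fockY fock_vac (Fock d) \<and>
      (\<forall>u n v. u \<notin> Fock d \<or> v \<notin> Fock d \<longrightarrow> fockY u n v = 0) \<and>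
      (\<forall>i<d. \<forall>n. \<forall>f\<in>Fock d. fockY (hmode i (-1) fock_vac) n f = hmode i n f)"
    using va' gens by (auto simp: fockY_def)
  then show "Y' = fockY" if "vertex_algebra fock_sc Y' fock_vac (Fock d) \<and>
      (\<forall>u n v. u \<notin> Fock d \<or> v \<notin> Fock d \<longrightarrow> Y' u n v = 0) \<and>
      (\<forall>i<d. \<forall>n. \<forall>f\<in>Fock d. Y' (hmode i (-1) fock_vac) n f = hmode i n f)" for Y'
    using that by (intro fock_structure_unique) blast+
qed

section \<open>The quadratic conformal vector\<close>

lemma heis_omega_in: "heis_omega d \<in> Fock d"
  unfolding heis_omega_def
  by (intro fock.subspace_scale[OF fock_subspace] fock.subspace_sum[OF fock_subspace] hmode_in
      fock_vac_in) auto

lemma fock_map_heis_omega: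
  "fock_map (heis_omega d) = sc (1/2) (\<Sum>j<d. Y (h j) (-1) (h j))"
proof -
  have map_sum: "fock_map (sum F K) = (\<Sum>j\<in>K. fock_map (F j))" if "\<And>j. j \<in> K \<Longrightarrow> F j \<in> Fock d"
    for F :: "nat \<Rightarrow> hstate" and K
    using that
    by (induction K rule: infinite_finite_induct)
       (auto simp: fock_map_zero fock_map_add fock.subspace_sum[OF fock_subspace] simp del: zero_fun_apply plus_fun_apply)
  have in_Fock: "hmode j (-1) (hmode j (-1) fock_vac) \<in> Fock d" if "j < d" for j
    using that by (intro hmode_in fock_vac_in)
  have "fock_map (heis_omega d) = sc (1/2) (fock_map (\<Sum>j<d. hmode j (-1) (hmode j (-1) fock_vac)))"
    unfolding heis_omega_def using in_Fock
    by (intro fock_map_scale fock.subspace_sum[OF fock_subspace]) auto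
  also have "fock_map (\<Sum>j<d. hmode j (-1) (hmode j (-1) fock_vac)) = (\<Sum>j<d. Y (h j) (-1) (h j))"
    using in_Fock
    by (subst map_sum) (auto simp: fock_map_hmode[OF hmode_in[OF fock_vac_in]] fock_map_generator)
  finally show ?thesis .
qed

text \<open>For \<open>j = i\<close> and \<open>n = 1\<close> the mode contracts with either of the
  two factors, giving \<open>2 h i\<close>, which cancels the factor 1/2.\<close>

lemma h_on_heis_omega:
  assumes "i < d" "n \<ge> 1"
  shows "Y (h i) n (fock_map (heis_omega d)) = (if n = 1 then h i else 0)"
proof -
  have "Y (h i) n (Y (h j) (-1) (h j)) = (if j = i then if n = 1 then sc 2 (h i) else 0 else 0)"
    if "j < d" for j
  proof -
    have "n + - 1 = 0 \<longleftrightarrow> n = 1" by auto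
    moreover have "h j + h j = sc 2 (h j)" using scale_left_distrib[of 1 1 "h j"] by simp
    ultimately show ?thesis
      using heisenberg_commutator[OF assms(1) that h_in[OF that], of n "-1"] h_h[OF assms(1) that, of n]
        assms that by (auto simp: Y_vac_right h_in)
  qed
  then have "(\<Sum>j<d. Y (h i) n (Y (h j) (-1) (h j))) = (if n = 1 then sc 2 (h i) else 0)"
    using assms by simp
  moreover have "Y (h i) n (fock_map (heis_omega d)) = sc (1/2) (\<Sum>j<d. Y (h i) n (Y (h j) (-1) (h j)))"
  proof -
    have "(\<Sum>j<d. Y (h j) (-1) (h j)) \<in> S" by (intro sum_in) (auto simp: Y_in h_in)
    moreover have "Y (h i) n (\<Sum>j<d. Y (h j) (-1) (h j)) = (\<Sum>j<d. Y (h i) n (Y (h j) (-1) (h j)))"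
      using assms by (intro Y_sum_right) (auto simp: Y_in h_in)
    ultimately show ?thesis
      unfolding fock_map_heis_omega using assms by (simp add: Y_sc_right h_in)
  qed
  ultimately show ?thesis by simp
qed

text \<open>The difference of the two vectors is killed by all positive modes of the
  \<open>h i\<close>. By injectivity all derivatives of its preimage vanish, so that preimage is
  constant.\<close>

lemma eq_heis_omega_plus_constant:
  assumes "\<omega> \<in> S" and "\<And>i n. i < d \<Longrightarrow> n \<ge> 1 \<Longrightarrow> Y (h i) n \<omega> = (if n = 1 then h i else 0)"
  obtains c where "\<omega> = fock_map (heis_omega d) + sc c vac"
proof -
  obtain f where f: "f \<in> Fock d" "fock_map f = \<omega>"
    using fock_map_inv[OF assms(1)] inv_fock_map_in[OF assms(1)] by blast
  let ?g = "f - heis_omega d"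
  have g: "?g \<in> Fock d" using f heis_omega_in fock.subspace_diff[OF fock_subspace] by blast
  have "fock_map (xder (i, n) ?g) = 0" if "i < d" "1 \<le> n" for i n
  proof (rule fock_map_xder_zero[OF g that])
    show "Y (h i) (int n) (fock_map ?g) = 0"
      using f heis_omega_in assms(2)[of i "int n"] h_on_heis_omega[of i "int n"] that assms(1)
      by (simp add: fock_map_diff Y_diff_right h_in fock_map_in)
  qed
  then have "xder (i, n) ?g = 0" if "i < d" "1 \<le> n" for i n
    using that g by (intro fock_map_kernel xder_in) auto
  then have "?g = fock_sc (?g (\<lambda>_. 0)) fock_vac" by (intro xder_zero_imp_constant[OF g])
  then have "fock_map ?g = sc (?g (\<lambda>_. 0)) vac"
    using fock_map_scale[OF fock_vac_in] fock_map_vac by metis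
  moreover have "\<omega> = fock_map (heis_omega d) + fock_map ?g"
    using f heis_omega_in by (simp add: fock_map_diff)
  ultimately show ?thesis using that by metis
qed

lemma voa_iso_Fock:
  assumes "fock_map (heis_omega d) = \<omega>"
  shows "voa_iso sc Y vac \<omega> S fock_sc (heisY d) fock_vac (heis_omega d) (Fock d)
           (inv_into (Fock d) fock_map)"
proof -
  let ?\<phi> = "inv_into (Fock d) fock_map"
  have "?\<phi> (u + v) = ?\<phi> u + ?\<phi> v" if "u \<in> S" "v \<in> S" for u v
    using that inv_fock_map[of "?\<phi> u + ?\<phi> v"]
    by (simp add: fock_map_add fock_map_inv inv_fock_map_in fock.subspace_add[OF fock_subspace])
  moreover have "?\<phi> (sc c u) = fock_sc c (?\<phi> u)" if "u \<in> S" for c u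
    using that inv_fock_map[of "fock_sc c (?\<phi> u)"]
    by (simp add: fock_map_scale fock_map_inv inv_fock_map_in fock.subspace_scale[OF fock_subspace])
  ultimately show ?thesis
    unfolding voa_iso_def heisY_eq_fockY
    using bij_betw_inv_into[OF fock_map_bij] assms inv_fock_map[OF heis_omega_in] inv_fock_map[OF fock_vac_in]
    by (auto simp: fockY_def inv_fock_map_in fock_map_inv fock_map_vac)
qed

end

section \<open>Weights and semi-conformal vectors\<close>

locale voa_alg = vertex_alg +
  fixes \<omega> :: 'a
  assumes conf: "conformal_vector sc Y S \<omega>"
begin

lemma omega_in: "\<omega> \<in> S"
  using conf by (simp add: conformal_vector_def)

lemma translation: "u \<in> S \<Longrightarrow> v \<in> S \<Longrightarrow> Y (Y \<omega> 0 u) n v = sc (- of_int n) (Y u (n - 1) v)"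
  using conf[unfolded conformal_vector_def, THEN conjunct2, THEN conjunct2, THEN conjunct1] by blast

lemma wt_iff: "v \<in> wt sc Y \<omega> S k \<longleftrightarrow> v \<in> S \<and> Y \<omega> 1 v = sc (of_int k) v"
  by (simp add: wt_def)

lemma subspace_wt: "subspace (wt sc Y \<omega> S k)"
  unfolding subspace_def
  by (auto simp: wt_iff omega_in add_in sc_in Y_add_right Y_sc_right scale_right_distrib mult.commute)

lemma wt_finite_span:
  obtains B where "finite B" "B \<subseteq> wt sc Y \<omega> S k" "wt sc Y \<omega> S k \<subseteq> span B"
proof -
  obtain B where B: "finite B" "B \<subseteq> wt sc Y \<omega> S k" "wt sc Y \<omega> S k \<subseteq> lin_span sc B"
    using conf[unfolded conformal_vector_def, THEN conjunct2, THEN conjunct2, THEN conjunct2,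
        THEN conjunct2, THEN conjunct1] by blast
  have "lin_span sc B \<subseteq> span B"
    unfolding lin_span_def by (auto intro!: span_sum span_scale intro: span_base)
  with B that show ?thesis by blast
qed

text \<open>The relation \<open>[L(0), L(-2)] = 2 L(-2)\<close> applied to the vacuum, where
  \<open>L(-2)\<close> gives \<open>\<omega>\<close> and \<open>L(0)\<close> gives 0.\<close>

lemma omega_wt: "\<omega> \<in> wt sc Y \<omega> S 2"
proof -
  obtain c where "\<forall>m n. \<forall>v\<in>S.
        Y \<omega> (m + 1) (Y \<omega> (n + 1) v) - Y \<omega> (n + 1) (Y \<omega> (m + 1) v) =
        sc (of_int (m - n)) (Y \<omega> (m + n + 1) v)
        + (if m + n = 0 then sc ((of_int m ^ 3 - of_int m) / 12 * c) v else 0)"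
    using conf[unfolded conformal_vector_def, THEN conjunct2, THEN conjunct1] by blast
  from this[rule_format, OF vac_in, of 0 "-2"] show ?thesis
    by (simp add: wt_iff omega_in Y_vac_right Y_vac_right_nonneg)
qed

lemma wt_mode:
  assumes u: "u \<in> wt sc Y \<omega> S k" and v: "v \<in> wt sc Y \<omega> S l"
  shows "Y u n v \<in> wt sc Y \<omega> S (k + l - n - 1)"
proof -
  have S: "\<omega> \<in> S" "u \<in> S" "v \<in> S" using u v by (auto simp: wt_iff omega_in)
  obtain M where "\<And>i. i \<ge> M \<Longrightarrow> Y \<omega> (0 + int i) u = 0"
    using truncation[OF S(1,2), of 0] unfolding eventually_sequentially by blast
  \<comment> \<open>The maximum with 2 ensures that the terms 0 and 1 occur in the sum. They are the
    only ones with nonzero binomial coefficient, and give translation and weight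
    respectively.\<close>
  then have M: "Y \<omega> (int i) u = 0" if "i \<ge> max M 2" for i using that by simp
  have ibin1: "ibin 1 i = 0" if "i \<ge> 2" for i
    using that binomial_gbinomial[of 1 i, where 'a = complex] by (simp add: ibin_def binomial_eq_0)
  have "Y \<omega> 1 (Y u n v) = Y u n (Y \<omega> 1 v)
      + (\<Sum>i<max M 2. sc (ibin 1 i) (Y (Y \<omega> (int i) u) (1 + n - int i) v))"
    by (rule commutator[OF S M])
  also have "(\<Sum>i<max M 2. sc (ibin 1 i) (Y (Y \<omega> (int i) u) (1 + n - int i) v)) =
      (\<Sum>i<2. sc (ibin 1 i) (Y (Y \<omega> (int i) u) (1 + n - int i) v))"
    using ibin1 by (intro sum_lessThan_extend) auto
  also have "\<dots> = sc (- of_int (1 + n)) (Y u n v) + sc (of_int k) (Y u n v)"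
    using u S by (simp add: numeral_2_eq_2 translation ibin_def wt_iff Y_sc_left)
  also have "Y u n (Y \<omega> 1 v) = sc (of_int l) (Y u n v)"
    using v S by (simp add: wt_iff Y_sc_right)
  also have "sc (of_int l) (Y u n v) + (sc (- of_int (1 + n)) (Y u n v) + sc (of_int k) (Y u n v)) =
      sc (of_int l + (- of_int (1 + n) + of_int k)) (Y u n v)"
    by (simp only: scale_left_distrib)
  also have "of_int l + (- of_int (1 + n) + of_int k) = (of_int (k + l - n - 1) :: complex)" by simp
  finally show ?thesis using S by (simp add: wt_iff Y_in)
qed

text \<open>Since \<open>x\<close> lies in its own subalgebra \<open>U\<close>, the agreement of
  modes on \<open>U\<close> can be evaluated at \<open>x\<close> itself.\<close>

lemma semi_conformal_props:
  assumes "x \<in> semi_conformal sc Y vac \<omega> S"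
  shows "x \<in> S" "\<And>n. n \<ge> 0 \<Longrightarrow> Y (\<omega> - x) n x = 0"
proof -
  obtain U where U: "vertex_subalgebra sc Y vac S U" "voa sc Y vac x U"
      "\<forall>u\<in>U. \<forall>n\<ge>0. Y \<omega> n u = Y x n u"
    using assms by (auto simp: semi_conformal_def)
  have xU: "x \<in> U" using U(2) by (simp add: voa_def conformal_vector_def)
  then show xS: "x \<in> S" using U(1) by (auto simp: vertex_subalgebra_def)
  show "Y (\<omega> - x) n x = 0" if "n \<ge> 0" for n
    using U(3) xU xS that by (simp add: Y_diff_left omega_in)
qed

text \<open>An element \<open>x\<close> of a semi-conformal chain lies in the double commutant of every later
  element \<open>y\<close>, and \<open>\<omega> - y\<close> lies in the commutant of \<open>y\<close>.\<close>

lemma semi_conformal_le_commutes: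
  assumes x: "x \<in> semi_conformal sc Y vac \<omega> S" and y: "y \<in> semi_conformal sc Y vac \<omega> S"
    and le: "sc_le sc Y vac S x y" and n: "n \<ge> 0"
  shows "Y (\<omega> - y) n x = 0"
proof (rule dcomm_commutes[of y])
  note S = semi_conformal_props(1)[OF x] semi_conformal_props(1)[OF y]
  show "y \<in> S" "\<omega> - y \<in> S" using S omega_in diff_in by auto
  then show "Y y n (\<omega> - y) = 0" if "n \<ge> 0" for n
    using commute_sym[of "\<omega> - y" y] semi_conformal_props[OF y] that by blast
  show "x \<in> dcomm sc Y vac S y" using self_in_dcomm[OF S(1)] le by (auto simp: sc_le_def)
qed (rule n)

lemma chain_differences_commute:
  assumes Sc: "\<And>i. i \<le> d \<Longrightarrow> ws i \<in> semi_conformal sc Y vac \<omega> S"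
    and le: "\<And>i. i < d \<Longrightarrow> sc_le sc Y vac S (ws i) (ws (Suc i))"
    and ij: "i < d" "j < d" "i \<noteq> j" and n: "n \<ge> 0"
  shows "Y (ws (Suc i) - ws i) n (ws (Suc j) - ws j) = 0"
proof -
  have in_S: "ws i \<in> S" if "i \<le> d" for i using semi_conformal_props(1)[OF Sc[OF that]] .
  have mono: "sc_le sc Y vac S (ws i) (ws j)" if "i \<le> j" "j \<le> d" for i j
    using that
  proof (induction j rule: dec_induct)
    case (step j)
    then show ?case using le[of j] by (simp add: sc_le_def)
  qed (simp add: sc_le_def)
  have zero: "Y (\<omega> - ws j) n (ws i) = 0" if "i \<le> j" "j \<le> d" "n \<ge> 0" for i j n
    using semi_conformal_le_commutes[OF Sc Sc mono, of i j n] that by simp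
  have less: "Y (ws (Suc j) - ws j) n (ws (Suc i) - ws i) = 0"
    if "i < j" "j < d" "n \<ge> 0" for i j n
  proof -
    \<comment> \<open>Both terms commute with \<open>ws i\<close> and \<open>ws (Suc i)\<close>,
      because \<open>Suc i \<le> j\<close>.\<close>
    have "ws (Suc j) - ws j = (\<omega> - ws j) - (\<omega> - ws (Suc j))" by simp
    then show ?thesis
      using that zero[of i j n] zero[of "Suc i" j n] zero[of i "Suc j" n] zero[of "Suc i" "Suc j" n]
      by (simp only: Y_diff_left Y_diff_right in_S omega_in diff_in) simp
  qed
  show ?thesis
  proof (cases "j < i")
    case False
    \<comment> \<open>\<open>less\<close> has the larger index on the left, so the case
      \<open>i < j\<close> needs the arguments exchanged.\<close>
    have "Y (ws (Suc j) - ws j) n (ws (Suc i) - ws i) = 0" if "n \<ge> 0" for n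
      using less[of i j n] ij False that by simp
    then show ?thesis
      using commute_sym[OF _ _ _ n] ij in_S diff_in by simp
  qed (use less ij n in simp)
qed

end

section \<open>Linear algebra of dimension\<close>

lemma (in vector_space) dim_nonzero_imp_nonzero_element:
  assumes "dim V \<noteq> 0"
  obtains v where "v \<in> V" "v \<noteq> 0"
proof -
  obtain B where B: "B \<subseteq> V" "independent B" "card B = dim V" using basis_exists by metis
  then have "B \<noteq> {}" using assms by auto
  then obtain v where v: "v \<in> B" by auto
  moreover have "v \<noteq> 0" using v B(2) dependent_zero by metis
  ultimately show ?thesis using that B(1) by auto
qed

text \<open>A vector outside the span would extend \<open>B\<close> to an independent set larger
  than a basis. The finite set \<open>T\<close> forces that basis to be finite, so cardinalities can
  be compared.\<close>

lemma (in vector_space) independent_card_dim_spans: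
  assumes V: "V \<subseteq> span T" "finite T" and B: "B \<subseteq> V" "independent B" "finite B" "card B = dim V"
  shows "V \<subseteq> span B"
proof
  fix x assume x: "x \<in> V"
  obtain C where C: "C \<subseteq> V" "independent C" "V \<subseteq> span C" "card C = dim V"
    using basis_exists by metis
  have "finite C" using independent_span_bound[OF V(2) C(2)] C(1) V(1) by blast
  show "x \<in> span B"
  proof (rule ccontr)
    assume "x \<notin> span B"
    then have "independent (insert x B)" "x \<notin> B"
      using independent_insertI[of x B] B(2) span_base[of x B] by auto
    moreover from this have "card (insert x B) \<le> card C"
      using independent_span_bound[OF \<open>finite C\<close>, of "insert x B"] C(3) x B(1) by blast
    ultimately show False using B(3,4) C(4) by simp
  qed
qed

theorem theorem1p5:
  fixes sc :: "complex \<Rightarrow> 'v::ab_group_add \<Rightarrow> 'v"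
    and Y :: "'v \<Rightarrow> int \<Rightarrow> 'v \<Rightarrow> 'v"
    and vac \<omega> :: 'v and S :: "'v set" and d :: nat
    and ws :: "nat \<Rightarrow> 'v"
  assumes vs: "vector_space sc"
    and voa: "voa sc Y vac \<omega> S"
    and cft: "nondeg_simple_CFT sc Y vac \<omega> S"
    and gen: "gen_subalg sc Y vac S (wt sc Y \<omega> S 1) = S"
    and dimV1: "vector_space.dim sc (wt sc Y \<omega> S 1) = d"
    and L1: "\<forall>v\<in>wt sc Y \<omega> S 1. Y \<omega> 2 v = 0"
    and chain0: "ws 0 = 0" and chaind: "ws d = \<omega>"
    and chainSc: "\<forall>i\<le>d. ws i \<in> semi_conformal sc Y vac \<omega> S"
    and chainlt: "\<forall>i\<in>{1..d}. sc_less sc Y vac S (ws (i - 1)) (ws i)"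
    and chaindim: "\<forall>i\<in>{1..d}.
        vector_space.dim sc (dcomm sc Y vac S (ws i - ws (i - 1)) \<inter> wt sc Y \<omega> S 1) \<noteq> 0"
  shows "\<exists>\<phi>. voa_iso sc Y vac \<omega> S fock_sc (heisY d) fock_vac (heis_omega d) (Fock d) \<phi>"
proof -
  interpret voa_alg sc Y vac S \<omega>
    using vs voa by (simp add: voa_alg_def vertex_alg_def vertex_alg_axioms_def
        voa_alg_axioms_def voa_def)
  let ?W = "\<lambda>k. wt sc Y \<omega> S k" and ?\<eta> = "\<lambda>i. ws (Suc i) - ws i"
  have W_neg: "?W k = {0}" if "k < 0" for k
    using cft that by (simp add: nondeg_simple_CFT_def)
  have W_0: "?W 0 = {sc c vac | c. True}"
    using cft by (simp add: nondeg_simple_CFT_def)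
  have nondeg: "u = 0" if "u \<in> ?W 1" "\<And>v. v \<in> ?W 1 \<Longrightarrow> Y u 1 v = 0" for u
    using cft that by (simp add: nondeg_simple_CFT_def)
  have vac_nonzero: "vac \<noteq> 0"
  proof
    assume "vac = 0"
    \<comment> \<open>Every vector is recovered from the vacuum by its mode -1.\<close>
    then have "S \<subseteq> {0}" using Y_vac_right Y_zero_right by (metis singletonI subsetI)
    then show False using cft zero_in by (auto simp: nondeg_simple_CFT_def simple_va_def)
  qed
  have W_S: "u \<in> S" if "u \<in> ?W k" for u k using that by (simp add: wt_iff)

  have \<eta>_in: "?\<eta> i \<in> S" if "i < d" for i
    using that chainSc semi_conformal_props(1) by (intro diff_in) auto
  have \<eta>_comm: "Y (?\<eta> i) n (?\<eta> j) = 0" if "i < d" "j < d" "i \<noteq> j" "n \<ge> 0" for i j n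
  proof (rule chain_differences_commute[OF _ _ that])
    show "sc_le sc Y vac S (ws i) (ws (Suc i))" if "i < d" for i
      using chainlt[rule_format, of "Suc i"] that by (simp add: sc_less_def)
  qed (use chainSc in auto)
  have omega_sum: "\<omega> = (\<Sum>i<d. ?\<eta> i)"
    using sum_lessThan_telescope[of ws d] chain0 chaind by simp

  \<comment> \<open>A basis of the weight one space\<close>
  have "\<exists>v. v \<in> dcomm sc Y vac S (?\<eta> i) \<inter> ?W 1 \<and> v \<noteq> 0" if "i < d" for i
    using chaindim[rule_format, of "Suc i"] that dim_nonzero_imp_nonzero_element by auto
  then obtain v where v: "\<And>i. i < d \<Longrightarrow> v i \<in> dcomm sc Y vac S (?\<eta> i)"
    and v_wt: "\<And>i. i < d \<Longrightarrow> v i \<in> ?W 1" and v_nz: "\<And>i. i < d \<Longrightarrow> v i \<noteq> 0"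
    by (metis IntD1 IntD2)
  have v_in: "v i \<in> S" if "i < d" for i using v_wt[OF that] by (rule W_S)
  have v_comm: "Y (v i) n (v j) = 0" if "i < d" "j < d" "i \<noteq> j" "n \<ge> 0" for i j n
    using dcomm_commute_dcomm[OF \<eta>_in \<eta>_in \<eta>_comm v v] that by blast
  \<comment> \<open>For \<open>j \<noteq> i\<close> the vector \<open>?\<eta> j\<close> commutes
    with \<open>?\<eta> i\<close>, hence with its whole double commutant.\<close>
  have \<eta>_v_other: "Y (?\<eta> j) 1 (v i) = 0" if "i < d" "j < d" "i \<noteq> j" for i j
    using dcomm_commutes[OF \<eta>_in \<eta>_in \<eta>_comm v] that by simp
  \<comment> \<open>The off-diagonal actions vanish and the \<open>?\<eta> k\<close> sum to
    \<open>\<omega>\<close>, so the diagonal one is the whole action of \<open>L(0)\<close>, with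
    eigenvalue 1.\<close>
  have \<eta>_v: "Y (?\<eta> j) 1 (v i) = (if i = j then v i else 0)" if "i < d" "j < d" for i j
  proof -
    have "v i = Y \<omega> 1 (v i)" using v_wt[OF that(1)] by (simp add: wt_iff)
    also have "\<dots> = (\<Sum>k<d. Y (?\<eta> k) 1 (v i))"
      using Y_sum_left[of "{..<d}" ?\<eta> "v i" 1] \<eta>_in v_in[OF that(1)] omega_sum by simp
    also have "\<dots> = (\<Sum>k<d. if k = i then Y (?\<eta> i) 1 (v i) else 0)"
      using \<eta>_v_other that by (intro sum.cong) auto
    also have "\<dots> = Y (?\<eta> i) 1 (v i)" using that by simp
    finally show ?thesis using \<eta>_v_other that by auto
  qed

  have v_inj: "inj_on v {..<d}"
  proof (rule inj_onI, rule ccontr)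
    fix i j assume ij: "i \<in> {..<d}" "j \<in> {..<d}" "v i = v j" "i \<noteq> j"
    then have "v i = 0" using \<eta>_v[of i i] \<eta>_v[of j i] by simp
    then show False using v_nz ij by simp
  qed
  have indep: "independent (v ` {..<d})"
  proof (rule independent_if_scalars_zero)
    fix f x assume sum0: "(\<Sum>x\<in>v ` {..<d}. sc (f x) x) = 0" and "x \<in> v ` {..<d}"
    then obtain j where j: "j < d" "x = v j" by auto
    \<comment> \<open>Applying \<open>Y (?\<eta> j) 1\<close> isolates the coefficient of
      \<open>v j\<close>.\<close>
    have "0 = Y (?\<eta> j) 1 (\<Sum>i<d. sc (f (v i)) (v i))"
      using sum0 \<eta>_in[OF j(1)] by (simp add: sum.reindex[OF v_inj])
    also have "\<dots> = (\<Sum>i<d. sc (f (v i)) (Y (?\<eta> j) 1 (v i)))"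
      using \<eta>_in[OF j(1)] v_in by (subst Y_sum_right) (auto simp: sc_in Y_sc_right)
    also have "\<dots> = (\<Sum>i<d. if i = j then sc (f x) x else 0)"
      using j \<eta>_v by (intro sum.cong) auto
    also have "\<dots> = sc (f x) x" using j by simp
    finally show "f x = 0" using v_nz j by simp
  qed simp
  have v_span: "?W 1 \<subseteq> span (v ` {..<d})"
  proof -
    obtain T where T: "finite T" "?W 1 \<subseteq> span T" using wt_finite_span by metis
    show ?thesis
    proof (rule independent_card_dim_spans[OF T(2,1) _ indep])
      show "v ` {..<d} \<subseteq> ?W 1" using v_wt by blast
      show "card (v ` {..<d}) = dim (?W 1)" unfolding card_image[OF v_inj] dimV1 by simp
    qed simp
  qed

  \<comment> \<open>Norms and the Heisenberg relations\<close>
  have v_norm: "\<exists>a. a \<noteq> 0 \<and> Y (v i) 1 (v i) = sc a vac" if i: "i < d" for i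
  proof -
    have "Y (v i) 1 (v i) \<in> ?W 0" using wt_mode[OF v_wt v_wt, OF i i, of 1] by simp
    then obtain a where a: "Y (v i) 1 (v i) = sc a vac" using W_0 by auto
    \<comment> \<open>Otherwise \<open>v i\<close> is orthogonal to every \<open>v j\<close>, hence
      to the whole weight one space, against nondegeneracy.\<close>
    have "a \<noteq> 0"
    proof
      assume "a = 0"
      let ?K = "{x \<in> S. Y (v i) 1 x = 0}"
      have "subspace ?K"
        unfolding subspace_def using v_in[OF i] by (auto simp: add_in sc_in Y_add_right Y_sc_right)
      moreover have "v j \<in> ?K" if "j < d" for j
        using v_comm[of i j 1] a \<open>a = 0\<close> i that v_in by (cases "i = j") auto
      ultimately have "span (v ` {..<d}) \<subseteq> ?K" by (intro span_minimal) auto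
      then have "Y (v i) 1 x = 0" if "x \<in> ?W 1" for x using v_span that by blast
      then have "v i = 0" by (rule nondeg[OF v_wt[OF i]])
      then show False using v_nz i by simp
    qed
    with a show ?thesis by blast
  qed
  then obtain a where a: "\<And>i. i < d \<Longrightarrow> a i \<noteq> 0" "\<And>i. i < d \<Longrightarrow> Y (v i) 1 (v i) = sc (a i) vac"
    by metis
  \<comment> \<open>These products have weight \<open>1 - n < 0\<close>.\<close>
  have v_high: "Y (v i) n (v i) = 0" if "i < d" "n \<ge> 2" for i n
    using wt_mode[OF v_wt v_wt, OF that(1,1), of n] W_neg[of "1 - n"] that by simp
  have v_bracket: "Y (v i) 0 (v i) = 0" if i: "i < d" for i
  proof -
    have "Y (v i) (0 + int k) (v i) = 0" if "k \<ge> 2" for k using v_high[OF i] that by simp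
    \<comment> \<open>The second term of skew-symmetry is a multiple of the translate of the vacuum,
      which is 0.\<close>
    then have "Y (v i) 0 (v i) = - Y (v i) 0 (v i)"
      using skew_symmetry[of "v i" "v i" 2 0] v_in[OF i] a(2)[OF i]
      by (simp add: numeral_2_eq_2 isign_def Y_vac_right Y_in Y_sc_left Y_vac_left)
    then have "Y (v i) 0 (v i) + Y (v i) 0 (v i) = 0" by (metis add.right_inverse)
    then have "sc 2 (Y (v i) 0 (v i)) = 0" using scale_left_distrib[of 1 1 "Y (v i) 0 (v i)"] by simp
    then show ?thesis by simp
  qed

  \<comment> \<open>Over the complex numbers every nonzero norm has a square root, so the orthogonal
    basis can be made orthonormal.\<close>
  define h where "h i = sc (inverse (csqrt (a i))) (v i)" for i
  have h_wt: "h i \<in> ?W 1" if "i < d" for i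
    unfolding h_def using v_wt[OF that] by (rule subspace_scale[OF subspace_wt])
  have h_in: "h i \<in> S" if "i < d" for i using h_wt[OF that] by (rule W_S)
  have h_h: "Y (h i) n (h j) = (if i = j \<and> n = 1 then vac else 0)"
    if ij: "i < d" "j < d" and n: "n \<ge> 0" for i j n
  proof -
    have eq: "Y (h i) n (h j) = sc (inverse (csqrt (a i)) * inverse (csqrt (a j))) (Y (v i) n (v j))"
      unfolding h_def using v_in ij by (simp add: Y_sc_left Y_sc_right sc_in)
    consider "i \<noteq> j" | "i = j" "n = 0" | "i = j" "n = 1" | "i = j" "n \<ge> 2" using n by linarith
    then show ?thesis
    proof cases
      case 3
      have "inverse (csqrt (a i)) * inverse (csqrt (a i)) * a i = inverse ((csqrt (a i))\<^sup>2) * a i"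
        by (simp add: power2_eq_square)
      also have "\<dots> = 1" using a(1)[OF ij(1)] by simp
      finally show ?thesis using 3 a(2)[OF ij(1)] eq by simp
    qed (use v_comm[OF ij] v_bracket v_high ij n eq in auto)
  qed
  \<comment> \<open>The \<open>h i\<close> are nonzero multiples of the \<open>v i\<close>, so a
    subalgebra containing them contains all of weight one.\<close>
  have "S \<subseteq> U" if U: "vertex_subalgebra sc Y vac S U" "h ` {..<d} \<subseteq> U" for U
  proof -
    have sub: "subspace U" using U(1) by (auto simp: vertex_subalgebra_def lin_subspace_def subspace_def)
    have "v i \<in> U" if "i < d" for i
    proof -
      have "v i = sc (csqrt (a i)) (h i)" using a(1)[OF that] by (simp add: h_def)
      then show ?thesis using U(2) that subspace_scale[OF sub] by auto
    qed
    then have "span (v ` {..<d}) \<subseteq> U" by (intro span_minimal sub) auto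
    then have "?W 1 \<subseteq> U" using v_span by blast
    then show ?thesis using gen gen_subalg_subset[OF U(1)] by metis
  qed
  moreover have "gen_subalg sc Y vac S (h ` {..<d}) \<subseteq> S"
    using h_in by (intro gen_subalg_subset vertex_subalgebra_S) auto
  ultimately have h_gen: "gen_subalg sc Y vac S (h ` {..<d}) = S"
    unfolding gen_subalg_def by blast

  \<comment> \<open>Matching the conformal vectors\<close>
  interpret H: heisenberg_va sc Y vac S d h
    by unfold_locales (fact h_in h_h vac_nonzero h_gen)+
  \<comment> \<open>\<open>Y \<omega> 2\<close> is \<open>L(1)\<close>, which vanishes by
    hypothesis; for larger \<open>n\<close> the result has weight \<open>2 - n < 0\<close>.\<close>
  have omega_h: "Y \<omega> n (h i) = 0" if "i < d" "n \<ge> 2" for i n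
  proof (cases "n = 2")
    case False
    then have "?W (2 - n) = {0}" using that W_neg by simp
    then show ?thesis using wt_mode[OF omega_wt h_wt[OF that(1)], of n] by simp
  qed (use L1 h_wt that in simp)
  have h_omega: "Y (h i) n \<omega> = (if n = 1 then h i else 0)" if i: "i < d" and n: "n \<ge> 1" for i n
  proof -
    have "Y \<omega> (n + int k) (h i) = 0" if "k \<ge> 1" for k using omega_h[OF i] n that by simp
    \<comment> \<open>Only the first skew-symmetry term survives, since all higher modes of
      \<open>\<omega>\<close> kill \<open>h i\<close>.\<close>
    then have skew: "sc (isign n) (Y (h i) n \<omega>) = - Y \<omega> n (h i)"
      using skew_symmetry[of \<omega> "h i" 1 n] omega_in h_in[OF i] by (simp add: Y_vac_right Y_in)
    show ?thesis
    proof (cases "n = 1")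
      case True
      then show ?thesis using skew h_wt[OF i] by (simp add: isign_def wt_iff)
    next
      case False
      then show ?thesis using skew omega_h[OF i, of n] n isign_cancel by simp
    qed
  qed
  then obtain c where c: "\<omega> = H.fock_map (heis_omega d) + sc c vac"
    using H.eq_heis_omega_plus_constant[OF omega_in] by blast
  have "H.fock_map (heis_omega d) \<in> ?W 2"
    unfolding H.fock_map_heis_omega using wt_mode[OF h_wt h_wt, where n = "-1"]
    by (intro subspace_scale[OF subspace_wt] subspace_sum[OF subspace_wt]) auto
  then have "\<omega> - H.fock_map (heis_omega d) \<in> ?W 2"
    by (rule subspace_diff[OF subspace_wt omega_wt])
  \<comment> \<open>The vacuum has weight 0, so a multiple of it in weight 2 must vanish.\<close>
  then have "sc c vac \<in> ?W 2" using c by (metis add_diff_cancel_left')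
  then have "sc (2 * c) vac = 0"
    using omega_in by (simp add: wt_iff Y_sc_right Y_vac_right_nonneg)
  then have "c = 0" using vac_nonzero by simp
  then show ?thesis using H.voa_iso_Fock[of \<omega>] c by auto
qed

end
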